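(* For $i=1,2$, let $T_i\in\mathcal{B}(\mathcal{H}_i)$ be an injective quasinormal operator with polar decomposition $T_i=V_i|T_i|$, and let $N_i\in\mathcal{B}(\mathcal{K}_i)$ be the minimal normal extension of $T_i$. For $X\in\mathcal{B}(\mathcal{H}_2,\mathcal{H}_1)$ the following are equivalent: (1) $X$ has an extension $\hat X\in\mathcal{B}(\mathcal{K}_2,\mathcal{K}_1)$ (i.e. $\hat X|_{\mathcal{H}_2}=X$) such that $N_1\hat X=\hat XN_2$ (such an extension is then unique); (2) $V_1X=XV_2$ and $|T_1|X=X|T_2|$.
   Context: Quasinormal: $T|T|=|T|T$. $T\in\mathcal{B}(\mathcal{H})$ is subnormal if $T=N|_{\mathcal{H}}$ for a normal $N$ on some $\mathcal{K}\supseteq\mathcal{H}$; such $N$ is a minimal normal extension if no proper reducing subspace of $\mathcal{K}$ for $N$ contains $\mathcal{H}$. Quasinormal operators are subnormal. *)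

theory Defs
  imports "HOL-Analysis.Analysis"
begin

class complex_vector = real_vector +
  fixes scaleC :: "complex \<Rightarrow> 'a \<Rightarrow> 'a"
  assumes scaleC_add_right: "scaleC a (x + y) = scaleC a x + scaleC a y"
    and scaleC_add_left: "scaleC (a + b) x = scaleC a x + scaleC b x"
    and scaleC_scaleC: "scaleC a (scaleC b x) = scaleC (a * b) x"
    and scaleC_one: "scaleC 1 x = x"
    and scaleR_scaleC: "scaleR r x = scaleC (complex_of_real r) x"

class complex_inner = complex_vector + real_normed_vector +
  fixes cinner :: "'a \<Rightarrow> 'a \<Rightarrow> complex"
  assumes cinner_commute: "cinner x y = cnj (cinner y x)"
    and cinner_add_left: "cinner (x + y) z = cinner x z + cinner y z"
    and cinner_scaleC_left: "cinner (scaleC r x) y = cnj r * cinner x y"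
    and cinner_self_real: "Im (cinner x x) = 0"
    and cinner_self_nonneg: "0 \<le> Re (cinner x x)"
    and cinner_self_eq_zero: "cinner x x = 0 \<longleftrightarrow> x = 0"
    and norm_eq_sqrt_cinner: "norm x = sqrt (Re (cinner x x))"

class chilbert_space = complex_inner + complete_space

definition clinear_op :: "('a::complex_vector \<Rightarrow> 'b::complex_vector) \<Rightarrow> bool" where
  "clinear_op f \<longleftrightarrow> (\<forall>x y. f (x + y) = f x + f y) \<and> (\<forall>c x. f (scaleC c x) = scaleC c (f x))"

definition bounded_clinear_op :: "('a::complex_inner \<Rightarrow> 'b::complex_inner) \<Rightarrow> bool" where
  "bounded_clinear_op f \<longleftrightarrow> clinear_op f \<and> (\<exists>K. \<forall>x. norm (f x) \<le> norm x * K)"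

text \<open>Hilbert space adjoint (for bounded operators between Hilbert spaces it exists and is unique).\<close>
definition cadjoint :: "('a::complex_inner \<Rightarrow> 'b::complex_inner) \<Rightarrow> ('b \<Rightarrow> 'a)" where
  "cadjoint T = (SOME A. \<forall>x y. cinner (T x) y = cinner x (A y))"

definition positive_op :: "('a::complex_inner \<Rightarrow> 'a) \<Rightarrow> bool" where
  "positive_op P \<longleftrightarrow> bounded_clinear_op P \<and>
     (\<forall>x. Im (cinner x (P x)) = 0 \<and> 0 \<le> Re (cinner x (P x)))"

definition abs_op :: "('a::complex_inner \<Rightarrow> 'b::complex_inner) \<Rightarrow> ('a \<Rightarrow> 'a)" where
  "abs_op T = (THE P. positive_op P \<and> P \<circ> P = cadjoint T \<circ> T)"

definition normal_op :: "('a::complex_inner \<Rightarrow> 'a) \<Rightarrow> bool" where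
  "normal_op N \<longleftrightarrow> bounded_clinear_op N \<and> cadjoint N \<circ> N = N \<circ> cadjoint N"

definition quasinormal :: "('a::complex_inner \<Rightarrow> 'a) \<Rightarrow> bool" where
  "quasinormal T \<longleftrightarrow> bounded_clinear_op T \<and> T \<circ> abs_op T = abs_op T \<circ> T"

definition partial_isometry :: "('a::complex_inner \<Rightarrow> 'b::complex_inner) \<Rightarrow> bool" where
  "partial_isometry V \<longleftrightarrow> bounded_clinear_op V \<and>
     (\<forall>x. (\<forall>y. V y = 0 \<longrightarrow> cinner y x = 0) \<longrightarrow> norm (V x) = norm x)"

definition polar_decomposition :: "('a::complex_inner \<Rightarrow> 'b::complex_inner) \<Rightarrow> ('a \<Rightarrow> 'b) \<Rightarrow> bool" where
  "polar_decomposition V T \<longleftrightarrow> partial_isometry V \<and> {x. V x = 0} = {x. T x = 0} \<and>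
     T = V \<circ> abs_op T"

definition closed_csubspace :: "'a::complex_inner set \<Rightarrow> bool" where
  "closed_csubspace M \<longleftrightarrow> 0 \<in> M \<and> (\<forall>x\<in>M. \<forall>y\<in>M. x + y \<in> M) \<and>
     (\<forall>c. \<forall>x\<in>M. scaleC c x \<in> M) \<and> closed M"

definition reducing_subspace :: "('a::complex_inner \<Rightarrow> 'a) \<Rightarrow> 'a set \<Rightarrow> bool" where
  "reducing_subspace N M \<longleftrightarrow> closed_csubspace M \<and> N ` M \<subseteq> M \<and> cadjoint N ` M \<subseteq> M"

text \<open>The inclusion \<open>\<H> \<subseteq> \<K>\<close> is represented by a linear isometric embedding \<open>U\<close>.\<close>
definition isometric_embedding :: "('a::complex_inner \<Rightarrow> 'b::complex_inner) \<Rightarrow> bool" where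
  "isometric_embedding U \<longleftrightarrow> bounded_clinear_op U \<and> (\<forall>x y. cinner (U x) (U y) = cinner x y)"

definition minimal_normal_extension ::
    "('k::complex_inner \<Rightarrow> 'k) \<Rightarrow> ('h::complex_inner \<Rightarrow> 'k) \<Rightarrow> ('h \<Rightarrow> 'h) \<Rightarrow> bool" where
  "minimal_normal_extension N U T \<longleftrightarrow> isometric_embedding U \<and> normal_op N \<and> N \<circ> U = U \<circ> T \<and>
     (\<forall>M. reducing_subspace N M \<and> range U \<subseteq> M \<longrightarrow> M = UNIV)"

end

theory Submission
  imports Defs "HOL-Complex_Analysis.Cauchy_Integral_Formula"
begin

text \<open>An intertwiner \<open>Y\<close> of two normal operators also intertwines their adjoints (Fuglede--Putnam). So
  an extension \<open>Y\<close> of \<open>X\<close> intertwines the \<open>N\<^sub>i\<^sup>* N\<^sub>i\<close>; quasinormality says that these restrict to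
  \<open>T\<^sub>i\<^sup>* T\<^sub>i\<close>, and taking square roots gives \<open>|T\<^sub>1| X = X |T\<^sub>2|\<close>, hence also \<open>V\<^sub>1 X = X V\<^sub>2\<close>. Fuglede--Putnam
  also makes the zero set of the difference of two extensions reducing, so extensions are unique.
  Conversely, the vectors \<open>\<Sum>\<^sub>k N\<^sub>i\<^sup>*\<^sup>k x\<^sub>k\<close> with all \<open>k < m\<close> are dense by minimality, and such a vector
  has the same norm as \<open>\<Sum>\<^sub>k V\<^sub>i\<^sup>2\<^sup>m\<^sup>-\<^sup>k |T\<^sub>i|\<^sup>k x\<^sub>k\<close>. If \<open>X\<close> satisfies (2), it intertwines the latter
  sums, so \<open>\<Sum>\<^sub>k N\<^sub>2\<^sup>*\<^sup>k x\<^sub>k \<mapsto> \<Sum>\<^sub>k N\<^sub>1\<^sup>*\<^sup>k X x\<^sub>k\<close> is well defined and bounded by \<open>\<parallel>X\<parallel>\<close>.\<close>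

section \<open>Complex inner product spaces and adjoints\<close>

lemma scaleC_zero_left [simp]: "scaleC 0 x = 0"
  using scaleC_add_left[of 0 0 x] by simp

lemma scaleC_zero_right [simp]: "scaleC c 0 = 0"
  using scaleC_add_right[of c 0 0] by simp

lemma scaleC_minus1: "scaleC (-1) x = - x"
  using scaleC_add_left[of 1 "-1" x] by (simp add: scaleC_one add_eq_0_iff)

lemma cinner_add_right: "cinner x (y + z) = cinner x y + cinner x z"
  by (metis cinner_commute cinner_add_left complex_cnj_add)

lemma cinner_scaleC_right: "cinner x (scaleC c y) = c * cinner x y"
proof -
  have "cinner x (scaleC c y) = cnj (cnj c * cinner y x)"
    by (metis cinner_commute cinner_scaleC_left)
  also have "\<dots> = c * cinner x y"
    by (metis cinner_commute complex_cnj_cnj complex_cnj_mult)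
  finally show ?thesis .
qed

lemma cinner_scaleR_left: "cinner (scaleR r x) y = of_real r * cinner x y"
  by (simp add: scaleR_scaleC cinner_scaleC_left)

lemma cinner_scaleR_right: "cinner x (scaleR r y) = of_real r * cinner x y"
  by (simp add: scaleR_scaleC cinner_scaleC_right)

lemma cinner_self: "cinner x x = of_real ((norm x)\<^sup>2)"
  by (simp add: complex_eq_iff cinner_self_real norm_eq_sqrt_cinner cinner_self_nonneg)

lemma Re_cinner_commute: "Re (cinner y x) = Re (cinner x y)"
  by (subst cinner_commute) simp

lemma norm_add_sq: "(norm (x + y))\<^sup>2 = (norm x)\<^sup>2 + 2 * Re (cinner x y) + (norm y)\<^sup>2"
  for x y :: "'a::complex_inner"
proof -
  have "complex_of_real ((norm (x + y))\<^sup>2) = cinner (x + y) (x + y)"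
    by (rule cinner_self[symmetric])
  also have "\<dots> = cinner x x + cinner x y + cinner y x + cinner y y"
    by (simp add: cinner_add_left cinner_add_right algebra_simps)
  finally have "Re (complex_of_real ((norm (x + y))\<^sup>2)) =
      Re (cinner x x + cinner x y + cinner y x + cinner y y)" by (rule arg_cong)
  then show ?thesis by (simp add: cinner_self Re_cinner_commute[of y x])
qed

lemma norm_scaleC: "norm (scaleC c x) = cmod c * norm x" for x :: "'a::complex_inner"
proof -
  have "complex_of_real ((norm (scaleC c x))\<^sup>2) = c * cnj c * cinner x x"
    unfolding cinner_self[symmetric] by (simp add: cinner_scaleC_left cinner_scaleC_right)
  also have "\<dots> = of_real ((cmod c * norm x)\<^sup>2)"
    by (simp add: complex_norm_square[symmetric] cinner_self power_mult_distrib)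
  finally have "complex_of_real ((norm (scaleC c x))\<^sup>2) = of_real ((cmod c * norm x)\<^sup>2)" .
  then have "(norm (scaleC c x))\<^sup>2 = (cmod c * norm x)\<^sup>2"
    by (simp only: of_real_eq_iff)
  then show ?thesis by (simp add: power2_eq_iff_nonneg)
qed

lemma norm_diff_sq: "(norm (x - y))\<^sup>2 = (norm x)\<^sup>2 - 2 * Re (cinner x y) + (norm y)\<^sup>2"
  for x y :: "'a::complex_inner"
proof -
  have "cinner x (- y) = - cinner x y"
    using cinner_scaleC_right[of x "-1" y] by (simp add: scaleC_minus1)
  then show ?thesis using norm_add_sq[of x "- y"] by simp
qed

text \<open>Expand the square of the norm of \<open>norm y *\<^sub>R x - norm x *\<^sub>R y\<close>:
  it is a nonnegative multiple of the gap in the inequality.\<close>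

lemma Re_cinner_le: "Re (cinner x y) \<le> norm x * norm y"
proof (cases "x = 0 \<or> y = 0")
  case True
  then show ?thesis
    by (metis cinner_scaleC_left cinner_scaleC_right mult_zero_left complex_cnj_zero norm_zero
        mult_zero_right order_refl scaleC_zero_left zero_complex.sel(1))
next
  case False
  have "0 \<le> (norm (norm y *\<^sub>R x - norm x *\<^sub>R y))\<^sup>2" by simp
  also have "\<dots> = 2 * (norm x * norm y) * (norm x * norm y - Re (cinner x y))"
    unfolding norm_diff_sq
    by (simp add: cinner_scaleR_left cinner_scaleR_right power2_eq_square algebra_simps)
  finally have "0 \<le> norm x * norm y - Re (cinner x y)"
    using False by (simp only: zero_le_mult_iff) (auto simp: mult_le_0_iff)
  then show ?thesis by simp
qed

lemma cinner_bound: "cmod (cinner x y) \<le> norm x * norm y"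
proof (cases "cinner x y = 0")
  case False
  \<comment> \<open>A unimodular factor that rotates \<open>cinner x y\<close> onto its modulus, so
    the bound on real parts suffices.\<close>
  define c where "c = cnj (cinner x y) / cmod (cinner x y)"
  have "c * cinner x y = cmod (cinner x y)"
    using False by (simp add: c_def complex_norm_square[symmetric] power2_eq_square field_simps
        mult.commute[of "cnj _"])
  then have "cmod (cinner x y) = Re (cinner x (scaleC c y))"
    by (simp add: cinner_scaleC_right)
  also have "\<dots> \<le> norm x * norm (scaleC c y)" by (rule Re_cinner_le)
  also have "norm (scaleC c y) = norm y"
    using False by (simp add: norm_scaleC c_def norm_divide)
  finally show ?thesis .
qed simp

text \<open>Conjugate-linearity in the first argument is still linearity over the reals, so the
  limit rules for real bilinear maps become available.\<close>

interpretation cinner: bounded_bilinear cinner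
proof
  show "\<exists>K. \<forall>a b. norm (cinner a b) \<le> norm a * norm b * K"
    by (rule exI[of _ 1]) (simp add: cinner_bound)
qed (simp_all add: cinner_add_left cinner_add_right cinner_scaleR_left cinner_scaleR_right
    scaleR_conv_of_real)

lemma cinner_eq_zero_all: "(\<And>y. cinner x y = 0) \<Longrightarrow> x = 0"
  using cinner_self_eq_zero by blast

lemma cinner_right_ext: "(\<And>u. cinner u x = cinner u y) \<Longrightarrow> x = y"
  by (metis cinner.diff_right cinner_self_eq_zero eq_iff_diff_eq_0)

instance chilbert_space \<subseteq> banach ..

section \<open>Bounded complex-linear operators, Riesz representation and adjoints\<close>

lemma bounded_clinear_op_iff:
  "bounded_clinear_op f \<longleftrightarrow> bounded_linear f \<and> (\<forall>c x. f (scaleC c x) = scaleC c (f x))"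
proof
  assume f: "bounded_clinear_op f"
  then obtain K where K: "\<And>x. norm (f x) \<le> norm x * K" and
    l: "\<And>x y. f (x + y) = f x + f y" "\<And>c x. f (scaleC c x) = scaleC c (f x)"
    unfolding bounded_clinear_op_def clinear_op_def by blast
  have "bounded_linear f"
    by (rule bounded_linear_intro[OF l(1) _ K]) (simp add: scaleR_scaleC l)
  then show "bounded_linear f \<and> (\<forall>c x. f (scaleC c x) = scaleC c (f x))" using l by blast
next
  assume f: "bounded_linear f \<and> (\<forall>c x. f (scaleC c x) = scaleC c (f x))"
  then interpret bounded_linear f by blast
  show "bounded_clinear_op f"
    unfolding bounded_clinear_op_def clinear_op_def using f bounded by (auto simp: add)
qed

lemma bounded_clinear_opD:
  assumes "bounded_clinear_op f"
  shows "bounded_linear f" "f (scaleC c x) = scaleC c (f x)"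
  using assms by (auto simp: bounded_clinear_op_iff)

lemma bounded_linear_scaleC: "bounded_linear (\<lambda>x::'a::complex_inner. scaleC c x)"
proof (rule bounded_linear_intro)
  show "norm (scaleC c x) \<le> norm x * cmod c" for x :: 'a by (simp add: norm_scaleC)
qed (simp_all add: scaleC_add_right scaleR_scaleC scaleC_scaleC mult.commute)

lemma bounded_clinear_op_scaleC: "bounded_clinear_op (scaleC c)"
  by (simp add: bounded_clinear_op_iff bounded_linear_scaleC scaleC_scaleC mult.commute)

lemma bounded_clinear_op_add:
  "bounded_clinear_op f \<Longrightarrow> bounded_clinear_op g \<Longrightarrow> bounded_clinear_op (\<lambda>x. f x + g x)"
  by (simp add: bounded_clinear_op_iff bounded_linear_add scaleC_add_right)

lemma scaleC_diff_right: "scaleC c (x - y) = scaleC c x - scaleC c (y::'a::complex_inner)"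
  by (rule linear_diff[OF bounded_linear.linear[OF bounded_linear_scaleC]])

lemma bounded_clinear_op_diff:
  "bounded_clinear_op f \<Longrightarrow> bounded_clinear_op g \<Longrightarrow> bounded_clinear_op (\<lambda>x. f x - g x)"
  by (simp add: bounded_clinear_op_iff bounded_linear_sub scaleC_diff_right)

lemma bounded_clinear_op_compose:
  "bounded_clinear_op f \<Longrightarrow> bounded_clinear_op g \<Longrightarrow> bounded_clinear_op (\<lambda>x. f (g x))"
  by (simp add: bounded_clinear_op_iff bounded_linear_compose)

lemma bounded_clinear_op_id: "bounded_clinear_op (\<lambda>x. x)"
  by (simp add: bounded_clinear_op_iff)

lemma bounded_clinear_op_funpow:
  fixes f :: "'a::complex_inner \<Rightarrow> 'a"
  shows "bounded_clinear_op f \<Longrightarrow> bounded_clinear_op (f ^^ n)"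
proof (induction n)
  case 0
  then show ?case using bounded_clinear_op_id by (simp add: id_def)
next
  case (Suc n)
  then show ?case using bounded_clinear_op_compose by (simp add: o_def)
qed

text \<open>The representing vector minimises \<open>\<parallel>x\<parallel>\<^sup>2 - 2 Re (\<phi> x)\<close>; by the parallelogram law every
  minimising sequence is Cauchy.\<close>

lemma riesz_representation:
  fixes \<phi> :: "'a::chilbert_space \<Rightarrow> complex"
  assumes bl: "bounded_linear \<phi>" and sc: "\<And>c x. \<phi> (scaleC c x) = c * \<phi> x"
  shows "\<exists>a. \<forall>x. \<phi> x = cinner a x"
proof -
  interpret phi: bounded_linear \<phi> by (rule bl)
  define J where "J x = (norm x)\<^sup>2 - 2 * Re (\<phi> x)" for x
  obtain K where K: "\<And>x. cmod (\<phi> x) \<le> norm x * K" using phi.bounded by blast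
  have lower: "- K\<^sup>2 \<le> J x" for x
  proof -
    have "Re (\<phi> x) \<le> norm x * K" using K[of x] complex_Re_le_cmod[of "\<phi> x"] by linarith
    moreover have "0 \<le> (norm x - K)\<^sup>2" by simp
    ultimately show ?thesis unfolding J_def by (simp add: power2_diff)
  qed
  define m where "m = Inf (range J)"
  have bdd: "bdd_below (range J)" using lower by (auto intro!: bdd_belowI)
  have m_le: "m \<le> J x" for x unfolding m_def by (rule cInf_lower[OF _ bdd]) simp
  have "\<exists>x. J x < m + inverse (real (Suc n))" for n
    using cInf_lessD[of "range J" "m + inverse (real (Suc n))"] unfolding m_def by auto
  then obtain s where s: "\<And>n. J (s n) < m + inverse (real (Suc n))" by metis
  \<comment> \<open>The parallelogram law; the linear terms of \<open>J\<close> cancel against those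
    at the midpoint.\<close>
  have par: "(norm (x - y))\<^sup>2 = 2 * J x + 2 * J y - 4 * J ((1/2) *\<^sub>R (x + y))" for x y
    unfolding J_def norm_diff_sq by (simp add: norm_add_sq phi.scaleR phi.add cinner_scaleR_left cinner_scaleR_right
        power_divide add_divide_distrib algebra_simps)
  have dist_s: "(norm (s i - s j))\<^sup>2 \<le> 2 * inverse (real (Suc i)) + 2 * inverse (real (Suc j))" for i j
    using par[of "s i" "s j"] m_le[of "(1/2) *\<^sub>R (s i + s j)"] s[of i] s[of j] by linarith
  have "Cauchy s"
  proof (rule CauchyI)
    fix e :: real assume e: "0 < e"
    obtain n where n: "inverse (real (Suc n)) < e\<^sup>2 / 4"
      using reals_Archimedean[of "e\<^sup>2 / 4"] e by auto
    show "\<exists>M. \<forall>i\<ge>M. \<forall>j\<ge>M. norm (s i - s j) < e"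
    proof (intro exI allI impI)
      fix i j assume "n \<le> i" "n \<le> j"
      then have "inverse (real (Suc i)) \<le> inverse (real (Suc n))"
        "inverse (real (Suc j)) \<le> inverse (real (Suc n))" by (auto intro!: le_imp_inverse_le)
      then have "(norm (s i - s j))\<^sup>2 < e\<^sup>2" using dist_s[of i j] n by linarith
      then show "norm (s i - s j) < e" using e by (simp add: power_less_imp_less_base)
    qed
  qed
  then obtain a where a: "s \<longlonglongrightarrow> a" using Cauchy_convergent_iff convergent_def by blast
  have "(\<lambda>n. J (s n)) \<longlonglongrightarrow> J a" unfolding J_def
    by (intro tendsto_intros a phi.tendsto)
  moreover have "(\<lambda>n. m + inverse (real (Suc n))) \<longlonglongrightarrow> m + 0"
    by (intro tendsto_intros LIMSEQ_inverse_real_of_nat)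
  ultimately have Ja: "J a \<le> m"
    using s by (intro LIMSEQ_le[of "\<lambda>n. J (s n)" _ "\<lambda>n. m + inverse (real (Suc n))"])
      (auto intro: less_imp_le)
  \<comment> \<open>Minimality of \<open>J\<close> at \<open>a\<close> makes its first variation in
    the direction \<open>h\<close> vanish.\<close>
  have Re_eq: "Re (cinner a h) = Re (\<phi> h)" for h
  proof (rule ccontr)
    assume ne: "Re (cinner a h) \<noteq> Re (\<phi> h)"
    define d where "d = Re (cinner a h) - Re (\<phi> h)"
    have quad: "0 \<le> 2 * t * d + t\<^sup>2 * (norm h)\<^sup>2" for t
    proof -
      have "J (a + t *\<^sub>R h) = J a + 2 * t * d + t\<^sup>2 * (norm h)\<^sup>2"
        unfolding J_def d_def norm_add_sq
        by (simp add: cinner_scaleR_right phi.add phi.scaleR power_mult_distrib algebra_simps)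
      then show ?thesis using m_le[of "a + t *\<^sub>R h"] Ja by linarith
    qed
    \<comment> \<open>The test value is \<open>t = - d / q\<close>; the added \<open>1\<close> keeps
      \<open>q\<close> positive even when \<open>h = 0\<close>.\<close>
    define q where "q = (norm h)\<^sup>2 + 1"
    have q: "q > 0" unfolding q_def by (simp add: add_nonneg_pos)
    have "0 \<le> 2 * (- d / q) * d + (- d / q)\<^sup>2 * (norm h)\<^sup>2" by (rule quad)
    also have "\<dots> \<le> 2 * (- d / q) * d + (- d / q)\<^sup>2 * q"
      by (intro add_left_mono mult_left_mono) (auto simp: q_def)
    also have "\<dots> = - (d\<^sup>2 / q)" using q by (simp add: power2_eq_square field_simps)
    finally have "d\<^sup>2 / q \<le> 0" by simp
    then have "d = 0" using q by (simp add: divide_le_0_iff)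
    then show False using ne by (simp add: d_def)
  qed
  show ?thesis
  proof (intro exI allI)
    fix x
    have "Im (cinner a x) = - Re (cinner a (scaleC \<i> x))" by (simp add: cinner_scaleC_right)
    also have "\<dots> = Im (\<phi> x)" unfolding Re_eq by (simp add: sc)
    finally show "\<phi> x = cinner a x" using Re_eq[of x] by (simp add: complex_eq_iff)
  qed
qed

text \<open>Riesz representation of \<open>\<lambda>x. cinner y (T x)\<close> supplies a witness for
  the choice in \<open>cadjoint\<close>.\<close>

lemma cadjoint_works:
  fixes T :: "'a::chilbert_space \<Rightarrow> 'b::chilbert_space"
  assumes T: "bounded_clinear_op T"
  shows "cinner (T x) y = cinner x (cadjoint T y)"
proof -
  interpret T: bounded_linear T by (rule bounded_clinear_opD[OF T])
  have "\<exists>a. \<forall>x. cinner y (T x) = cinner a x" for y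
    by (rule riesz_representation)
      (auto intro: bounded_linear_compose[OF cinner.bounded_linear_right T.bounded_linear]
        simp: bounded_clinear_opD[OF T] cinner_scaleC_right)
  then obtain A where "\<And>x y. cinner y (T x) = cinner (A y) x" by metis
  then have "\<forall>x y. cinner (T x) y = cinner x (A y)" by (metis cinner_commute)
  then have "\<forall>x y. cinner (T x) y = cinner x (cadjoint T y)"
    unfolding cadjoint_def by (rule someI[where P = "\<lambda>A. \<forall>x y. cinner (T x) y = cinner x (A y)"])
  then show ?thesis by blast
qed

text \<open>Nondegeneracy of the inner product forces linearity, and Cauchy-Schwarz for
  \<open>cinner (T (A y)) y\<close> bounds \<open>(norm (A y))\<^sup>2\<close>.\<close>

lemma adjoint_bounded_clinear:
  fixes T :: "'a::complex_inner \<Rightarrow> 'b::complex_inner"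
  assumes T: "bounded_clinear_op T" and adj: "\<And>x y. cinner (T x) y = cinner x (A y)"
  shows "bounded_clinear_op A"
proof -
  interpret T: bounded_linear T by (rule bounded_clinear_opD[OF T])
  obtain K where K: "\<And>x. norm (T x) \<le> norm x * K" and "0 < K" using T.pos_bounded by blast
  show ?thesis unfolding bounded_clinear_op_def clinear_op_def
  proof (intro conjI allI exI)
    show "A (x + y) = A x + A y" for x y
      by (rule cinner_right_ext) (simp add: adj[symmetric] cinner_add_right)
    show "A (scaleC c x) = scaleC c (A x)" for c x
      by (rule cinner_right_ext) (simp add: adj[symmetric] cinner_scaleC_right)
    show "norm (A y) \<le> norm y * K" for y
    proof (cases "A y = 0")
      case False
      have "(norm (A y))\<^sup>2 = cmod (cinner (A y) (A y))" by (simp add: cinner_self norm_power)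
      also have "\<dots> = cmod (cinner (T (A y)) y)" by (simp add: adj)
      also have "\<dots> \<le> norm (T (A y)) * norm y" by (rule cinner_bound)
      also have "\<dots> \<le> norm (A y) * K * norm y" by (intro mult_right_mono K) simp
      finally show ?thesis using False by (simp add: power2_eq_square mult.assoc mult.commute)
    qed (use \<open>0 < K\<close> in simp)
  qed
qed

lemma cadjoint_bounded_clinear:
  fixes T :: "'a::chilbert_space \<Rightarrow> 'b::chilbert_space"
  assumes "bounded_clinear_op T"
  shows "bounded_clinear_op (cadjoint T)"
  by (rule adjoint_bounded_clinear[OF assms cadjoint_works[OF assms]])

lemma adjoint_swap:
  assumes "\<And>x y. cinner (f x) y = cinner x (g y)"
  shows "cinner (g x) y = cinner x (f y)"
  by (metis assms cinner_commute)

lemma adjoint_funpow: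
  fixes f g :: "'a::complex_inner \<Rightarrow> 'a"
  assumes "\<And>x y. cinner (f x) y = cinner x (g y)"
  shows "cinner ((f ^^ n) x) y = cinner x ((g ^^ n) y)"
proof (induction n arbitrary: y)
  case (Suc n)
  have "cinner ((f ^^ Suc n) x) y = cinner x ((g ^^ n) (g y))" by (simp add: assms Suc)
  then show ?case by (simp add: funpow_swap1)
qed simp

lemma funpow_commute:
  assumes "\<And>x. f (g x) = h (f x)"
  shows "f ((g ^^ n) x) = (h ^^ n) (f x)"
  by (induction n) (simp_all add: assms)

text \<open>Normality as used for Fuglede-Putnam: both squared norms equal
  \<open>cinner x (f (g x))\<close>.\<close>

lemma norm_adjoint_eq:
  assumes adj: "\<And>x y. cinner (f x) y = cinner x (g y)" and comm: "\<And>x. f (g x) = g (f x)"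
  shows "norm (g x) = norm (f x)"
proof -
  have "cinner (g x) (g x) = cinner (f x) (f x)"
    by (metis adj adjoint_swap comm)
  then show ?thesis by (simp add: norm_eq_sqrt_cinner)
qed

section \<open>The Fuglede--Putnam theorem\<close>

text \<open>The product of \<open>1 + cnj w N\<close> and \<open>1 - w M\<close> is \<open>1 + S - |w|\<^sup>2 N M\<close> with \<open>S\<close> skew-adjoint, so its
  norm has no first-order term in \<open>w\<close>.\<close>

lemma near_isometry_bound:
  fixes N M :: "'a::complex_inner \<Rightarrow> 'a"
  assumes bN: "bounded_clinear_op N" and bM: "bounded_clinear_op M"
    and adj: "\<And>x y. cinner (N x) y = cinner x (M y)"
    and c: "\<And>x. norm (N x) \<le> norm x * c" "\<And>x. norm (M x) \<le> norm x * c" "c \<ge> 0"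
  defines "D \<equiv> \<lambda>w y. y - scaleC w (M y)"
  shows "norm (D w y + scaleC (cnj w) (N (D w y))) \<le> (1 + 3 * (cmod w)\<^sup>2 * c\<^sup>2) * norm y"
proof -
  interpret N: bounded_linear N by (rule bounded_clinear_opD[OF bN])
  define s where "s = scaleC (cnj w) (N y) - scaleC w (M y)"
  define r where "r = scaleC (cnj w) (N (scaleC w (M y)))"
  have eq: "D w y + scaleC (cnj w) (N (D w y)) = (y + s) - r"
    by (simp add: D_def s_def r_def N.diff scaleC_diff_right)
  \<comment> \<open>Skew-adjointness makes \<open>cinner y s\<close> purely imaginary, so the cross
    term in \<open>norm_add_sq\<close> vanishes.\<close>
  have "cnj (cinner y s) = - cinner y s"
  proof -
    have "cnj (cinner y s) = cinner s y" by (metis cinner_commute)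
    also have "\<dots> = w * cinner y (M y) - cnj w * cinner y (N y)"
      by (simp add: s_def cinner.diff_left cinner_scaleC_left adj adjoint_swap[OF adj])
    also have "\<dots> = - cinner y s"
      by (simp add: s_def cinner.diff_right cinner_scaleC_right)
    finally show ?thesis .
  qed
  then have "Re (cinner y s) = 0" by (simp add: complex_eq_iff)
  moreover have ns: "norm s \<le> 2 * (cmod w * c * norm y)"
  proof -
    have "norm s \<le> cmod w * norm (N y) + cmod w * norm (M y)"
      unfolding s_def by (rule order_trans[OF norm_triangle_ineq4]) (simp add: norm_scaleC)
    also have "\<dots> \<le> cmod w * (norm y * c) + cmod w * (norm y * c)"
      by (intro add_mono mult_left_mono c) auto
    finally show ?thesis by (simp add: algebra_simps)
  qed
  ultimately have "(norm (y + s))\<^sup>2 \<le> (norm y)\<^sup>2 + (2 * (cmod w * c * norm y))\<^sup>2"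
    unfolding norm_add_sq using power_mono[OF ns, of 2] by simp
  \<comment> \<open>With \<open>t = (cmod w)\<^sup>2 * c\<^sup>2\<close> this is
    \<open>1 + 4 * t \<le> (1 + 2 * t)\<^sup>2\<close>; the remainder \<open>r\<close> contributes
    one more \<open>t\<close>, whence the constant 3.\<close>
  also have "\<dots> \<le> ((1 + 2 * (cmod w)\<^sup>2 * c\<^sup>2) * norm y)\<^sup>2"
  proof -
    have "((1 + 2 * (cmod w)\<^sup>2 * c\<^sup>2) * norm y)\<^sup>2 = (norm y)\<^sup>2 + (2 * (cmod w * c * norm y))\<^sup>2
        + (2 * (cmod w)\<^sup>2 * c\<^sup>2 * norm y)\<^sup>2"
      by (simp add: power2_eq_square algebra_simps)
    then show ?thesis by simp
  qed
  finally have 1: "norm (y + s) \<le> (1 + 2 * (cmod w)\<^sup>2 * c\<^sup>2) * norm y"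
    by (rule power2_le_imp_le) (simp add: c)
  have 2: "norm r \<le> (cmod w)\<^sup>2 * c\<^sup>2 * norm y"
  proof -
    have "norm r = cmod w * norm (N (scaleC w (M y)))" by (simp add: r_def norm_scaleC)
    also have "\<dots> \<le> cmod w * (norm (scaleC w (M y)) * c)" by (intro mult_left_mono c) simp
    also have "\<dots> = (cmod w)\<^sup>2 * c * norm (M y)" by (simp add: norm_scaleC power2_eq_square)
    also have "\<dots> \<le> (cmod w)\<^sup>2 * c * (norm y * c)" by (intro mult_left_mono c) (simp add: c)
    finally show ?thesis by (simp add: power2_eq_square algebra_simps)
  qed
  have "norm (y + s - r) \<le> norm (y + s) + norm r" by (rule norm_triangle_ineq4)
  then show ?thesis unfolding eq using 1 2 by (simp add: algebra_simps)
qed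

text \<open>Testing against vectors \<open>u\<close> in the linear slot of the inner product reduces
  everything to scalar complex analysis. The vectors \<open>a\<close> and \<open>b\<close> are the
  value and the derivative at 0.\<close>

definition weakly_entire :: "(complex \<Rightarrow> 'a::complex_inner) \<Rightarrow> 'a \<Rightarrow> 'a \<Rightarrow> bool" where
  "weakly_entire f a b \<longleftrightarrow> f 0 = a \<and>
     (\<forall>u. (\<lambda>w. cinner u (f w)) holomorphic_on UNIV \<and>
          ((\<lambda>w. cinner u (f w)) has_field_derivative cinner u b) (at 0))"

lemma weakly_entire_const: "weakly_entire (\<lambda>_. v) v 0"
  by (simp add: weakly_entire_def cinner.zero_right)

text \<open>The adjoint moves \<open>B\<close> onto the test vector, where the hypothesis on
  \<open>f\<close> applies.\<close>

lemma weakly_entire_image: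
  assumes "weakly_entire f a b" and "\<And>x y. cinner (A x) y = cinner x (B y)"
  shows "weakly_entire (\<lambda>w. B (f w)) (B a) (B b)"
  using assms(1) unfolding weakly_entire_def by (simp add: assms(2)[symmetric])

text \<open>By the product rule the new term contributes only \<open>B a\<close> at 0, since its
  factor \<open>w\<close> vanishes there.\<close>

lemma weakly_entire_step:
  assumes f: "weakly_entire f a b" and adj: "\<And>x y. cinner (A x) y = cinner x (B y)"
  shows "weakly_entire (\<lambda>w. f w + scaleC w (B (f w))) a (b + B a)"
  unfolding weakly_entire_def
proof (intro conjI allI)
  show "f 0 + scaleC 0 (B (f 0)) = a" using f by (simp add: weakly_entire_def)
  fix u
  have eq: "(\<lambda>w. cinner u (f w + scaleC w (B (f w)))) =
      (\<lambda>w. cinner u (f w) + w * cinner (A u) (f w))"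
    by (simp add: cinner_add_right cinner_scaleC_right adj)
  show "(\<lambda>w. cinner u (f w + scaleC w (B (f w)))) holomorphic_on UNIV"
    unfolding eq using f by (intro holomorphic_intros) (auto simp: weakly_entire_def)
  show "((\<lambda>w. cinner u (f w + scaleC w (B (f w)))) has_field_derivative cinner u (b + B a)) (at 0)"
  proof -
    have 1: "((\<lambda>w. cinner u (f w)) has_field_derivative cinner u b) (at 0)"
      and 2: "((\<lambda>w. cinner (A u) (f w)) has_field_derivative cinner (A u) b) (at 0)" and "f 0 = a"
      using f unfolding weakly_entire_def by blast+
    then show ?thesis unfolding eq
      by (auto intro!: derivative_eq_intros 1 2 simp: cinner_add_right adj)
  qed
qed

lemma weakly_entire_funpow:
  assumes f: "weakly_entire f a b" and adj: "\<And>x y. cinner (A x) y = cinner x (B y)"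
    and B: "bounded_linear B"
  shows "weakly_entire (\<lambda>w. ((\<lambda>y. y + scaleC w (B y)) ^^ n) (f w)) a (b + of_nat n *\<^sub>R B a)"
proof (induction n)
  case (Suc n)
  then show ?case
    using weakly_entire_step[OF Suc adj] by (simp add: algebra_simps)
qed (simp add: f)

text \<open>The vector polynomial \<open>p w = (1 + w M\<^sub>1)\<^sup>n X (1 - w M\<^sub>2)\<^sup>n v\<close> has derivative
  \<open>n (M\<^sub>1 X - X M\<^sub>2) v\<close> at \<open>0\<close>. As \<open>1 + cnj w N\<^sub>1\<close> is normal, replacing \<open>w M\<^sub>1\<close> by \<open>cnj w N\<^sub>1\<close>
  does not change the norm of \<open>p w\<close>; commuting the first power past \<open>X\<close> then gives
  \<open>\<parallel>p w\<parallel> \<le> \<parallel>X\<parallel> (1 + 3 |w|\<^sup>2 c\<^sup>2)\<^sup>n \<parallel>v\<parallel>\<close>, and Cauchy's estimate on \<open>|w| = 1 / sqrt n\<close> bounds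
  \<open>n (M\<^sub>1 X - X M\<^sub>2) v\<close> by a multiple of \<open>sqrt n\<close>.\<close>

theorem fuglede_putnam:
  fixes N1 M1 :: "'a::chilbert_space \<Rightarrow> 'a" and N2 M2 :: "'b::chilbert_space \<Rightarrow> 'b"
  assumes bN1: "bounded_clinear_op N1" and adj1: "\<And>x y. cinner (N1 x) y = cinner x (M1 y)"
    and comm1: "\<And>x. N1 (M1 x) = M1 (N1 x)"
    and bN2: "bounded_clinear_op N2" and adj2: "\<And>x y. cinner (N2 x) y = cinner x (M2 y)"
    and comm2: "\<And>x. N2 (M2 x) = M2 (N2 x)"
    and bX: "bounded_clinear_op X" and inter: "\<And>x. N1 (X x) = X (N2 x)"
  shows "M1 (X v) = X (M2 v)"
proof -
  have bM1: "bounded_clinear_op M1" and bM2: "bounded_clinear_op M2"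
    using adjoint_bounded_clinear[OF bN1 adj1] adjoint_bounded_clinear[OF bN2 adj2] .
  interpret N1: bounded_linear N1 by (rule bounded_clinear_opD[OF bN1])
  interpret N2: bounded_linear N2 by (rule bounded_clinear_opD[OF bN2])
  interpret M1: bounded_linear M1 by (rule bounded_clinear_opD[OF bM1])
  interpret M2: bounded_linear M2 by (rule bounded_clinear_opD[OF bM2])
  interpret X: bounded_linear X by (rule bounded_clinear_opD[OF bX])
  note sc = bounded_clinear_opD(2)[OF bN1] bounded_clinear_opD(2)[OF bN2]
    bounded_clinear_opD(2)[OF bM1] bounded_clinear_opD(2)[OF bM2] bounded_clinear_opD(2)[OF bX]
  obtain K where K: "\<And>x. norm (X x) \<le> norm x * K" "0 < K" using X.pos_bounded by blast
  obtain c1 where c1: "\<And>x. norm (N2 x) \<le> norm x * c1" "0 < c1" using N2.pos_bounded by blast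
  obtain c2 where c2: "\<And>x. norm (M2 x) \<le> norm x * c2" "0 < c2" using M2.pos_bounded by blast
  define c where "c = c1 + c2"
  have c: "norm (N2 x) \<le> norm x * c" "norm (M2 x) \<le> norm x * c" "c \<ge> 0" for x
    using c1(2) c2(2) order_trans[OF c1(1), of x "norm x * c"]
      order_trans[OF c2(1), of x "norm x * c"]
    by (simp_all add: c_def mult_left_mono)
  define A where "A w y = y + scaleC (cnj w) (N1 y)" for w y
  define As where "As w y = y + scaleC w (M1 y)" for w y
  define C where "C w y = y + scaleC (cnj w) (N2 y)" for w y
  \<comment> \<open>Written as a sum with \<open>- M2 y\<close>, as
    \<open>weakly_entire_funpow\<close> requires; \<open>D_alt\<close> gives the form for
    \<open>near_isometry_bound\<close>.\<close>
  define D where "D w y = y + scaleC w (- M2 y)" for w y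
  define p where "p n w = (As w ^^ n) (X ((D w ^^ n) v))" for n w
  have D_alt: "D w y = y - scaleC w (M2 y)" for w y
    unfolding D_def using scaleC_diff_right[of w 0 "M2 y"] by simp
  have bound: "norm (p n w) \<le> K * (1 + 3 * (cmod w)\<^sup>2 * c\<^sup>2) ^ n * norm v" for n w
  proof -
    define q where "q = 1 + 3 * (cmod w)\<^sup>2 * c\<^sup>2"
    have q: "q \<ge> 0" by (simp add: q_def)
    have "cinner (A w x) y = cinner x (As w y)" for x y
      by (simp add: A_def As_def cinner_add_left cinner_add_right cinner_scaleC_left
          cinner_scaleC_right adj1)
    then have adjn: "cinner ((A w ^^ n) x) y = cinner x ((As w ^^ n) y)" for x y
      by (rule adjoint_funpow)
    have commA: "A w (As w x) = As w (A w x)" for x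
      by (simp add: A_def As_def N1.add M1.add sc scaleC_add_right scaleC_scaleC comm1 mult.commute)
    then have commn: "(A w ^^ n) ((As w ^^ n) x) = (As w ^^ n) ((A w ^^ n) x)" for x
      by (intro funpow_commute) (metis funpow_commute)
    have commC: "C w (D w x) = D w (C w x)" for x
      by (simp add: C_def D_alt N2.add N2.diff M2.add M2.diff sc scaleC_add_right scaleC_diff_right
          scaleC_scaleC comm2 mult.commute)
    have AX: "A w (X y) = X (C w y)" for y
      by (simp add: A_def C_def X.add sc inter)
    \<comment> \<open>By commutation one \<open>C w\<close> and one \<open>D w\<close> can act on
      \<open>y\<close> first, at the cost of a factor \<open>q\<close>; induction peels off one such
      pair at a time.\<close>
    have CD: "norm ((C w ^^ n) ((D w ^^ n) y)) \<le> q ^ n * norm y" for n y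
    proof (induction n arbitrary: y)
      case (Suc n)
      have "(C w ^^ Suc n) ((D w ^^ Suc n) y) = (C w ^^ n) (C w (D w ((D w ^^ n) y)))"
        by (simp add: funpow_swap1)
      also have "\<dots> = (C w ^^ n) ((D w ^^ n) (C w (D w y)))"
        by (simp add: commC funpow_swap1 funpow_commute[of "C w" "D w" "D w"])
      finally have "norm ((C w ^^ Suc n) ((D w ^^ Suc n) y)) \<le> q ^ n * norm (C w (D w y))"
        using Suc[of "C w (D w y)"] by simp
      also have "\<dots> \<le> q ^ n * (q * norm y)"
        using near_isometry_bound[OF bN2 bM2 adj2 c, where w = w and y = y] q
        by (intro mult_left_mono) (auto simp: C_def D_alt q_def)
      finally show ?case by (simp add: algebra_simps)
    qed simp
    have "norm (p n w) = norm ((A w ^^ n) (X ((D w ^^ n) v)))"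
      unfolding p_def by (rule norm_adjoint_eq[OF adjn commn])
    also have "\<dots> = norm (X ((C w ^^ n) ((D w ^^ n) v)))"
      by (simp add: funpow_commute[of X "C w" "A w", OF AX[symmetric]])
    also have "\<dots> \<le> norm ((C w ^^ n) ((D w ^^ n) v)) * K" by (rule K)
    also have "\<dots> \<le> (q ^ n * norm v) * K" using CD K(2) by (intro mult_right_mono) auto
    finally show ?thesis by (simp add: q_def algebra_simps)
  qed
  define d where "d = M1 (X v) - X (M2 v)"
  have we: "weakly_entire (p n) (X v) (of_nat n *\<^sub>R d)" for n
  proof -
    have "cinner (- N2 x) y = cinner x (- M2 y)" for x y
      by (simp add: cinner.minus_left cinner.minus_right adj2)
    from weakly_entire_funpow[OF weakly_entire_const[of v] this
        bounded_linear_minus[OF M2.bounded_linear], of n]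
    have "weakly_entire (\<lambda>w. (D w ^^ n) v) v (0 + of_nat n *\<^sub>R - M2 v)"
      unfolding D_def .
    from weakly_entire_image[OF this adjoint_swap[OF cadjoint_works[OF bX]]]
    have "weakly_entire (\<lambda>w. X ((D w ^^ n) v)) (X v) (X (0 + of_nat n *\<^sub>R - M2 v))" .
    from weakly_entire_funpow[OF this adj1 M1.bounded_linear, of n]
    show ?thesis unfolding p_def As_def d_def
      by (simp add: X.scaleR X.neg scaleR_diff_right)
  qed
  define L where "L = norm d * K * exp (3 * c\<^sup>2) * norm v"
  have est: "sqrt (real n) * (norm d)\<^sup>2 \<le> L" if n: "n > 0" for n
  proof -
    \<comment> \<open>On this radius \<open>(1 + 3 * r\<^sup>2 * c\<^sup>2) ^ n\<close> stays below
      \<open>exp (3 * c\<^sup>2)\<close>, while dividing by \<open>r\<close> costs only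
      \<open>sqrt n\<close>.\<close>
    define r where "r = 1 / sqrt (real n)"
    have r: "r > 0" "r\<^sup>2 = 1 / real n" using n by (auto simp: r_def power_divide)
    \<comment> \<open>Testing with \<open>d\<close> itself makes the derivative at 0 equal to
      \<open>n * (norm d)\<^sup>2\<close>.\<close>
    define g where "g w = cinner d (p n w)" for w
    have hol: "g holomorphic_on UNIV" and der: "(g has_field_derivative cinner d (of_nat n *\<^sub>R d)) (at 0)"
      using we[of n] unfolding weakly_entire_def g_def by auto
    have "(1 + 3 * r\<^sup>2 * c\<^sup>2) ^ n \<le> exp (3 * r\<^sup>2 * c\<^sup>2) ^ n"
      by (intro power_mono exp_ge_add_one_self) (simp add: add_nonneg_nonneg)
    also have "\<dots> = exp (real n * (3 * r\<^sup>2 * c\<^sup>2))" by (rule exp_of_nat_mult[symmetric])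
    also have "\<dots> = exp (3 * c\<^sup>2)" using n by (simp add: r)
    finally have q: "(1 + 3 * r\<^sup>2 * c\<^sup>2) ^ n \<le> exp (3 * c\<^sup>2)" .
    have "norm ((deriv ^^ 1) g 0) \<le> fact 1 * L / r ^ 1"
    proof (rule Cauchy_inequality)
      show "g holomorphic_on ball 0 r" using hol holomorphic_on_subset by blast
      show "continuous_on (cball 0 r) g"
        using hol holomorphic_on_imp_continuous_on continuous_on_subset by blast
      fix w :: complex assume "norm (0 - w) = r"
      then have w: "cmod w = r" by simp
      have "cmod (g w) \<le> norm d * norm (p n w)" unfolding g_def by (rule cinner_bound)
      also have "\<dots> \<le> norm d * (K * (1 + 3 * r\<^sup>2 * c\<^sup>2) ^ n * norm v)"
        using bound[of n w] by (intro mult_left_mono) (auto simp: w)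
      also have "\<dots> \<le> norm d * (K * exp (3 * c\<^sup>2) * norm v)"
        using q K(2) by (intro mult_left_mono mult_right_mono) auto
      finally show "cmod (g w) \<le> L" by (simp add: L_def mult.assoc)
    qed (use r in auto)
    moreover have "deriv g 0 = of_nat n * of_real ((norm d)\<^sup>2)"
      using DERIV_imp_deriv[OF der] by (simp add: cinner_scaleR_right cinner_self)
    ultimately have "real n * (norm d)\<^sup>2 \<le> L * sqrt (real n)"
      by (simp add: norm_mult norm_power r_def)
    then have "sqrt (real n) * (sqrt (real n) * (norm d)\<^sup>2) \<le> sqrt (real n) * L"
      by (simp add: mult.assoc[symmetric] mult.commute)
    then show ?thesis using n by simp
  qed
  have "d = 0"
  proof (rule ccontr)
    assume "d \<noteq> 0"
    then have pos: "(norm d)\<^sup>2 > 0" by simp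
    \<comment> \<open>\<open>L\<close> does not depend on \<open>n\<close>, so a large
      \<open>n\<close> violates \<open>est\<close>.\<close>
    obtain n where n: "real n > (L / (norm d)\<^sup>2)\<^sup>2" using reals_Archimedean2 by blast
    then have "n > 0" by (cases n) auto
    have "L / (norm d)\<^sup>2 < sqrt (real n)" using n by (rule real_less_rsqrt)
    then have "L < sqrt (real n) * (norm d)\<^sup>2" using pos by (simp add: pos_divide_less_eq)
    then show False using est[OF \<open>n > 0\<close>] by simp
  qed
  then show ?thesis by (simp add: d_def)
qed

section \<open>Positive operators and square roots\<close>

lemma positive_opD:
  assumes "positive_op P"
  shows "bounded_clinear_op P" "Im (cinner x (P x)) = 0" "0 \<le> Re (cinner x (P x))"
  using assms by (auto simp: positive_op_def)

text \<open>Polarisation: reality of the form at \<open>x + y\<close> relates the imaginary parts,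
  and replacing \<open>y\<close> by \<open>scaleC \<i> y\<close> relates the real parts.\<close>

lemma positive_op_selfadjoint:
  assumes P: "positive_op P"
  shows "cinner (P x) y = cinner x (P y)"
proof -
  interpret P: bounded_linear P by (rule bounded_clinear_opD[OF positive_opD(1)[OF P]])
  have sc: "P (scaleC c x) = scaleC c (P x)" for c x
    by (rule bounded_clinear_opD[OF positive_opD(1)[OF P]])
  have im: "Im (cinner x (P y)) + Im (cinner y (P x)) = 0" for x y
    using positive_opD(2)[OF P, of "x + y"] positive_opD(2)[OF P, of x] positive_opD(2)[OF P, of y]
    by (simp add: P.add cinner_add_left cinner_add_right)
  have "Re (cinner x (P y)) = Re (cinner y (P x))"
    using im[of x "scaleC \<i> y"] by (simp add: sc cinner_scaleC_left cinner_scaleC_right)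
  then have "cinner x (P y) = cnj (cinner y (P x))"
    using im[of x y] by (simp add: complex_eq_iff)
  then show ?thesis by (metis cinner_commute)
qed

lemma positive_op_add:
  "positive_op P \<Longrightarrow> positive_op Q \<Longrightarrow> positive_op (\<lambda>x. P x + Q x)"
  by (auto simp: positive_op_def cinner_add_right intro: bounded_clinear_op_add)

lemma bounded_clinear_op_scaleR:
  "bounded_clinear_op f \<Longrightarrow> bounded_clinear_op (\<lambda>x. r *\<^sub>R f x)"
  using bounded_clinear_op_compose[OF bounded_clinear_op_scaleC] by (simp add: scaleR_scaleC)

lemma positive_op_scaleR:
  "positive_op P \<Longrightarrow> 0 \<le> r \<Longrightarrow> positive_op (\<lambda>x. r *\<^sub>R P x)"
  by (auto simp: positive_op_def cinner_scaleR_right intro: bounded_clinear_op_scaleR)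

lemma positive_op_conj:
  assumes P: "positive_op P" and F: "bounded_clinear_op F"
    and adj: "\<And>x y. cinner (F x) y = cinner x (G y)"
  shows "positive_op (\<lambda>x. G (P (F x)))"
  using P bounded_clinear_op_compose[OF adjoint_bounded_clinear[OF F adj]
      bounded_clinear_op_compose[OF positive_opD(1)[OF P] F]]
  by (simp add: positive_op_def adj[symmetric])

lemma positive_op_id: "positive_op (\<lambda>x. x)"
  by (simp add: positive_op_def bounded_clinear_op_id cinner_self)

text \<open>A power is \<open>F F\<close> or \<open>F P F\<close> with the self-adjoint
  \<open>F = P ^^ (k div 2)\<close>, so it is a conjugate of the identity or of
  \<open>P\<close>.\<close>

lemma positive_op_funpow:
  assumes P: "positive_op P"
  shows "positive_op (P ^^ k)"
proof -
  let ?F = "P ^^ (k div 2)"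
  have F: "bounded_clinear_op ?F" by (rule bounded_clinear_op_funpow[OF positive_opD(1)[OF P]])
  have adj: "cinner (?F x) y = cinner x (?F y)" for x y
    by (rule adjoint_funpow[OF positive_op_selfadjoint[OF P]])
  show ?thesis
  proof (cases "even k")
    case True
    then have "k = k div 2 + k div 2" by presburger
    then have "P ^^ k = (\<lambda>x. ?F (?F x))" by (metis funpow_add o_def)
    then show ?thesis using positive_op_conj[OF positive_op_id F adj] by simp
  next
    case False
    then have "k = k div 2 + Suc (k div 2)" by presburger
    then have "P ^^ k = (\<lambda>x. ?F (P (?F x)))" by (metis funpow_add funpow.simps(2) o_def)
    then show ?thesis using positive_op_conj[OF P F adj] by simp
  qed
qed

text \<open>This is the operator inequality \<open>P^2 \<le> c P\<close>: test positivity at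
  \<open>x - t *\<^sub>R P x\<close> with \<open>t = 1 / c\<close>.\<close>

lemma positive_op_norm_sq_le:
  assumes P: "positive_op P" and c: "\<And>x. norm (P x) \<le> norm x * c" "c > 0"
  shows "(norm (P x))\<^sup>2 \<le> c * Re (cinner x (P x))"
proof -
  interpret P: bounded_linear P by (rule bounded_clinear_opD[OF positive_opD(1)[OF P]])
  define t where "t = 1 / c"
  have "Re (cinner (P x) (P (P x))) \<le> norm (P x) * norm (P (P x))" by (rule Re_cinner_le)
  also have "\<dots> \<le> norm (P x) * (norm (P x) * c)" by (intro mult_left_mono c) simp
  finally have 1: "Re (cinner (P x) (P (P x))) \<le> c * (norm (P x))\<^sup>2"
    by (simp add: power2_eq_square algebra_simps)
  have "0 \<le> Re (cinner (x - t *\<^sub>R P x) (P (x - t *\<^sub>R P x)))" by (rule positive_opD(3)[OF P])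
  also have "\<dots> = Re (cinner x (P x)) - 2 * t * (norm (P x))\<^sup>2 + t\<^sup>2 * Re (cinner (P x) (P (P x)))"
    using arg_cong[OF positive_op_selfadjoint[OF P, of x "P x"], of Re]
    by (simp add: P.diff P.scaleR cinner.diff_left cinner.diff_right cinner_scaleR_left
        cinner_scaleR_right cinner_self power2_eq_square algebra_simps)
  also have "\<dots> \<le> Re (cinner x (P x)) - 2 * t * (norm (P x))\<^sup>2 + t\<^sup>2 * (c * (norm (P x))\<^sup>2)"
    by (intro add_left_mono mult_left_mono 1) simp
  also have "\<dots> = Re (cinner x (P x)) - (norm (P x))\<^sup>2 / c"
    using c(2) by (simp add: t_def power2_eq_square field_simps)
  finally show ?thesis using c(2) by (simp add: field_simps)
qed

lemma positive_op_null:
  assumes P: "positive_op P" and "Re (cinner x (P x)) = 0"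
  shows "P x = 0"
proof -
  interpret P: bounded_linear P by (rule bounded_clinear_opD[OF positive_opD(1)[OF P]])
  obtain c where "\<And>x. norm (P x) \<le> norm x * c" "c > 0" using P.pos_bounded by blast
  from positive_op_norm_sq_le[OF P this, of x] assms(2) show ?thesis by simp
qed

text \<open>Polynomials in \<open>B\<close> with nonnegative coefficients. For positive
  \<open>B\<close> they are positive, commute and are closed under composition, which replaces a
  general result on products of commuting positive operators.\<close>

inductive nonneg_poly :: "('a::complex_inner \<Rightarrow> 'a) \<Rightarrow> ('a \<Rightarrow> 'a) \<Rightarrow> bool" for B where
  zero: "nonneg_poly B (\<lambda>x. 0)"
| id: "nonneg_poly B (\<lambda>x. x)"
| step: "nonneg_poly B f \<Longrightarrow> nonneg_poly B (\<lambda>x. B (f x))"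
| add: "nonneg_poly B f \<Longrightarrow> nonneg_poly B g \<Longrightarrow> nonneg_poly B (\<lambda>x. f x + g x)"
| scale: "nonneg_poly B f \<Longrightarrow> 0 \<le> r \<Longrightarrow> nonneg_poly B (\<lambda>x. r *\<^sub>R f x)"

lemma nonneg_poly_compose:
  assumes "nonneg_poly B f" "nonneg_poly B g"
  shows "nonneg_poly B (\<lambda>x. f (g x))"
  using assms by (induction rule: nonneg_poly.induct) (auto intro: nonneg_poly.intros)

lemma nonneg_poly_intertwine:
  assumes "bounded_linear B" "bounded_linear C" "\<And>x. C (B x) = B (C x)" "nonneg_poly B f"
  shows "C (f x) = f (C x)"
  using assms(4)
  by induction (simp_all add: assms(3) linear_0 linear_add linear_scale
      bounded_linear.linear[OF assms(2)])

text \<open>Positivity of \<open>f\<close> does not directly give that of \<open>B\<close> after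
  \<open>f\<close>. With an arbitrary power of \<open>B\<close> in front, that case only raises the
  exponent by one.\<close>

lemma nonneg_poly_positive_funpow:
  assumes B: "positive_op B" and f: "nonneg_poly B f"
  shows "positive_op (\<lambda>x. (B ^^ k) (f x))"
  using f
proof (induction arbitrary: k)
  case zero
  then show ?case
    using positive_op_scaleR[OF positive_op_id, of 0] bounded_clinear_op_funpow[OF positive_opD(1)[OF B]]
    by (simp add: linear_0 bounded_linear.linear bounded_clinear_opD(1))
next
  case id
  then show ?case using positive_op_funpow[OF B] by simp
next
  case (step f)
  from step(2)[of "Suc k"] show ?case by (simp add: funpow_swap1)
next
  case (add f g)
  then show ?case
    using bounded_clinear_op_funpow[OF positive_opD(1)[OF B], of k]
      positive_op_add[OF add(3)[of k] add(4)[of k]]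
    by (simp add: linear_add bounded_linear.linear bounded_clinear_opD(1))
next
  case (scale f r)
  then show ?case
    using bounded_clinear_op_funpow[OF positive_opD(1)[OF B], of k]
      positive_op_scaleR[OF scale(3)[of k], of r]
    by (simp add: linear_scale bounded_linear.linear bounded_clinear_opD(1))
qed

lemma nonneg_poly_positive:
  "positive_op B \<Longrightarrow> nonneg_poly B f \<Longrightarrow> positive_op f"
  using nonneg_poly_positive_funpow[of B f 0] by simp

lemma nonneg_poly_commute:
  assumes B: "positive_op B" and f: "nonneg_poly B f" and g: "nonneg_poly B g"
  shows "f (g x) = g (f x)"
proof -
  note bl = bounded_clinear_opD(1)[OF positive_opD(1)]
  have "f (B x) = B (f x)" for x
    using nonneg_poly_intertwine[OF bl[OF B] bl[OF B] refl f] by simp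
  then show ?thesis
    using nonneg_poly_intertwine[where C = f, OF bl[OF B] bl[OF nonneg_poly_positive[OF B f]] _ g]
    by blast
qed

section \<open>Square roots of positive operators by monotone iteration\<close>

primrec sqrt_iter :: "('a::complex_inner \<Rightarrow> 'a) \<Rightarrow> nat \<Rightarrow> 'a \<Rightarrow> 'a" where
  "sqrt_iter B 0 = (\<lambda>x. 0)"
| "sqrt_iter B (Suc n) = (\<lambda>x. (1/2) *\<^sub>R (B x + sqrt_iter B n (sqrt_iter B n x)))"

lemma sqrt_iter_nonneg_poly: "nonneg_poly B (sqrt_iter B n)"
proof (induction n)
  case (Suc n)
  have "nonneg_poly B (\<lambda>x. sqrt_iter B n (sqrt_iter B n x))"
    by (rule nonneg_poly_compose[OF Suc Suc])
  then have "nonneg_poly B (\<lambda>x. (1/2) *\<^sub>R (B x + sqrt_iter B n (sqrt_iter B n x)))"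
    by (intro nonneg_poly.scale[OF nonneg_poly.add[OF nonneg_poly.step[OF nonneg_poly.id]]]) simp_all
  then show ?case by simp
qed (simp add: nonneg_poly.zero)

lemma sqrt_iter_intertwine:
  assumes "bounded_linear X" and "\<And>x. B (X x) = X (C x)"
  shows "sqrt_iter B n (X x) = X (sqrt_iter C n x)"
  by (induction n arbitrary: x) (simp_all add: assms(2) linear_0 linear_add linear_scale
      bounded_linear.linear[OF assms(1)])

text \<open>If \<open>B\<close> is a positive contraction, the increasing sequence \<open>Y\<^sub>n\<^sub>+\<^sub>1 = (B + Y\<^sub>n\<^sup>2) / 2\<close> converges
  strongly to a solution of \<open>(1 - Y)\<^sup>2 = 1 - B\<close>.\<close>

context
  fixes B :: "'a::chilbert_space \<Rightarrow> 'a"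
  assumes B: "positive_op B" and B_le: "\<And>x. norm (B x) \<le> norm x"
begin

lemma sqrt_iter_positive: "positive_op (sqrt_iter B n)"
  by (rule nonneg_poly_positive[OF B sqrt_iter_nonneg_poly])

lemma sqrt_iter_bounded_clinear: "bounded_clinear_op (sqrt_iter B n)"
  by (rule positive_opD(1)[OF sqrt_iter_positive])

lemmas sqrt_iter_diff = linear_diff[OF bounded_linear.linear[OF
      bounded_clinear_opD(1)[OF sqrt_iter_bounded_clinear]]]

lemmas sqrt_iter_add = linear_add[OF bounded_linear.linear[OF
      bounded_clinear_opD(1)[OF sqrt_iter_bounded_clinear]]]

text \<open>Since the iterates commute, the next increment is half the product of the current
  increment \<open>?Y - ?Z\<close> with the sum \<open>?Y + ?Z\<close>.\<close>

lemma sqrt_iter_step: "nonneg_poly B (\<lambda>x. sqrt_iter B (Suc n) x - sqrt_iter B n x)"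
proof (induction n)
  case 0
  show ?case using nonneg_poly.scale[OF nonneg_poly.step[OF nonneg_poly.id], of "1/2" B] by simp
next
  case (Suc n)
  let ?Y = "sqrt_iter B (Suc n)" and ?Z = "sqrt_iter B n"
  have "nonneg_poly B (\<lambda>x. (1/2) *\<^sub>R (\<lambda>y. ?Y y - ?Z y) (?Y x + ?Z x))"
    by (intro nonneg_poly.scale nonneg_poly_compose[OF Suc nonneg_poly.add[OF
          sqrt_iter_nonneg_poly sqrt_iter_nonneg_poly]]) simp
  moreover have "(1/2) *\<^sub>R (?Y (?Y x + ?Z x) - ?Z (?Y x + ?Z x)) = sqrt_iter B (Suc (Suc n)) x - ?Y x" for x
  proof -
    have "?Z (?Y x) = ?Y (?Z x)"
      by (rule nonneg_poly_commute[OF B]) (rule sqrt_iter_nonneg_poly)+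
    then have 1: "?Y (?Y x + ?Z x) - ?Z (?Y x + ?Z x) = ?Y (?Y x) - ?Z (?Z x)"
      unfolding sqrt_iter_add by simp
    have 2: "sqrt_iter B (Suc (Suc n)) x - ?Y x =
        (1/2) *\<^sub>R (B x + ?Y (?Y x)) - (1/2) *\<^sub>R (B x + ?Z (?Z x))"
      by simp
    show ?thesis unfolding 1 2 by (simp only: scaleR_diff_right[symmetric] add_diff_cancel_left)
  qed
  ultimately show ?case by (simp only:)
qed

lemma sqrt_iter_mono:
  assumes "m \<le> n"
  shows "nonneg_poly B (\<lambda>x. sqrt_iter B n x - sqrt_iter B m x)"
  using assms
proof (induction n rule: dec_induct)
  case base
  show ?case by (simp add: nonneg_poly.zero)
next
  case (step n)
  from nonneg_poly.add[OF sqrt_iter_step[of n] step(3)] show ?case by simp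
qed

lemma sqrt_iter_le: "norm (sqrt_iter B n x) \<le> norm x"
proof (induction n arbitrary: x)
  case (Suc n)
  have "norm (B x + sqrt_iter B n (sqrt_iter B n x)) \<le> norm x + norm x"
    by (intro norm_triangle_mono B_le order_trans[OF Suc Suc])
  then show ?case by simp
qed simp

text \<open>The forms \<open>a n\<close> increase and are bounded, hence Cauchy;
  \<open>positive_op_norm_sq_le\<close> for differences of iterates, which have bound 2, turns this
  into convergence in norm.\<close>

lemma sqrt_iter_convergent: "convergent (\<lambda>n. sqrt_iter B n x)"
proof -
  define a where "a n = Re (cinner x (sqrt_iter B n x))" for n
  have diff: "a n - a m = Re (cinner x (sqrt_iter B n x - sqrt_iter B m x))" for m n
    by (simp add: a_def cinner.diff_right)
  have "incseq a"
    using diff positive_opD(3)[OF nonneg_poly_positive[OF B sqrt_iter_mono]]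
    by (intro incseq_SucI) (metis diff_ge_0_iff_ge le_add2 plus_1_eq_Suc)
  moreover have "a n \<le> norm x * norm x" for n
    unfolding a_def by (rule order_trans[OF Re_cinner_le]) (simp add: mult_left_mono sqrt_iter_le)
  ultimately have "Cauchy a"
    by (meson Bseq_mono_convergent LIMSEQ_imp_Cauchy convergent_def incseq_convergent)
  have step: "(norm (sqrt_iter B n x - sqrt_iter B m x))\<^sup>2 \<le> 2 * norm (a n - a m)" for n m
  proof (induction m n rule: linorder_wlog)
    case (le m n)
    have bd: "norm (sqrt_iter B n y - sqrt_iter B m y) \<le> norm y * 2" for y
      using norm_triangle_ineq4[of "sqrt_iter B n y" "sqrt_iter B m y"]
        sqrt_iter_le[of n y] sqrt_iter_le[of m y] by linarith
    have "(norm (sqrt_iter B n x - sqrt_iter B m x))\<^sup>2 \<le> 2 * (a n - a m)"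
      unfolding diff
      by (rule positive_op_norm_sq_le[OF nonneg_poly_positive[OF B sqrt_iter_mono[OF le]] bd]) simp
    then show ?case by (simp add: abs_if)
  qed (simp add: norm_minus_commute abs_minus_commute)
  have "Cauchy (\<lambda>n. sqrt_iter B n x)"
  proof (rule CauchyI)
    fix e :: real assume e: "0 < e"
    then obtain M where M: "\<And>m n. m \<ge> M \<Longrightarrow> n \<ge> M \<Longrightarrow> norm (a m - a n) < e\<^sup>2 / 2"
      using CauchyD[OF \<open>Cauchy a\<close>, of "e\<^sup>2 / 2"] by auto
    have "norm (sqrt_iter B m x - sqrt_iter B n x) < e" if "m \<ge> M" "n \<ge> M" for m n
    proof (rule power_less_imp_less_base)
      show "(norm (sqrt_iter B m x - sqrt_iter B n x))\<^sup>2 < e\<^sup>2"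
        using step[of m n] M[OF that] by linarith
    qed (use e in simp)
    then show "\<exists>M. \<forall>m\<ge>M. \<forall>n\<ge>M. norm (sqrt_iter B m x - sqrt_iter B n x) < e" by blast
  qed
  then show ?thesis by (rule Cauchy_convergent)
qed

definition sqrt_lim :: "'a \<Rightarrow> 'a" where
  "sqrt_lim x = lim (\<lambda>n. sqrt_iter B n x)"

lemma sqrt_lim: "(\<lambda>n. sqrt_iter B n x) \<longlonglongrightarrow> sqrt_lim x"
  unfolding sqrt_lim_def by (rule convergent_LIMSEQ_iff[THEN iffD1, OF sqrt_iter_convergent])

lemma sqrt_lim_le: "norm (sqrt_lim x) \<le> norm x"
  by (rule LIMSEQ_le_const2[OF tendsto_norm[OF sqrt_lim]]) (simp add: sqrt_iter_le)

lemma sqrt_lim_bounded_clinear: "bounded_clinear_op sqrt_lim"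
  unfolding bounded_clinear_op_def clinear_op_def
proof (intro conjI allI exI)
  fix x y :: 'a and c :: complex
  have "(\<lambda>n. sqrt_iter B n (x + y)) \<longlonglongrightarrow> sqrt_lim x + sqrt_lim y"
    unfolding sqrt_iter_add by (intro tendsto_add sqrt_lim)
  then show "sqrt_lim (x + y) = sqrt_lim x + sqrt_lim y"
    by (rule LIMSEQ_unique[OF sqrt_lim])
  have "(\<lambda>n. sqrt_iter B n (scaleC c x)) \<longlonglongrightarrow> scaleC c (sqrt_lim x)"
    unfolding bounded_clinear_opD(2)[OF sqrt_iter_bounded_clinear]
    by (intro bounded_linear.tendsto[OF bounded_linear_scaleC] sqrt_lim)
  then show "sqrt_lim (scaleC c x) = scaleC c (sqrt_lim x)"
    by (rule LIMSEQ_unique[OF sqrt_lim])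
  show "norm (sqrt_lim x) \<le> norm x * 1" using sqrt_lim_le by simp
qed

text \<open>The recursion passes to the limit: the iterates are contractions, so
  \<open>?Y n (?Y n x - sqrt_lim x)\<close> tends to 0.\<close>

lemma sqrt_lim_eq: "sqrt_lim (sqrt_lim x) = 2 *\<^sub>R sqrt_lim x - B x"
proof -
  let ?Y = "sqrt_iter B"
  have "(\<lambda>n. ?Y n (?Y n x - sqrt_lim x)) \<longlonglongrightarrow> 0"
  proof (rule Lim_null_comparison)
    show "(\<lambda>n. norm (?Y n x - sqrt_lim x)) \<longlonglongrightarrow> 0"
      using sqrt_lim[of x] by (simp add: tendsto_norm_zero_iff LIM_zero)
  qed (auto simp: sqrt_iter_le)
  from tendsto_add[OF this sqrt_lim[of "sqrt_lim x"]]
  have "(\<lambda>n. ?Y n (?Y n x)) \<longlonglongrightarrow> sqrt_lim (sqrt_lim x)"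
    by (simp add: sqrt_iter_diff)
  then have "(\<lambda>n. ?Y (Suc n) x) \<longlonglongrightarrow> (1/2) *\<^sub>R (B x + sqrt_lim (sqrt_lim x))"
    unfolding sqrt_iter.simps by (intro tendsto_intros)
  moreover have "(\<lambda>n. ?Y (Suc n) x) \<longlonglongrightarrow> sqrt_lim x"
    by (rule LIMSEQ_Suc[OF sqrt_lim])
  ultimately have "sqrt_lim x = (1/2) *\<^sub>R (B x + sqrt_lim (sqrt_lim x))"
    using LIMSEQ_unique by blast
  then have "2 *\<^sub>R sqrt_lim x = 2 *\<^sub>R ((1/2) *\<^sub>R (B x + sqrt_lim (sqrt_lim x)))" by (rule arg_cong)
  then have "2 *\<^sub>R sqrt_lim x = B x + sqrt_lim (sqrt_lim x)" by simp
  then show ?thesis by simp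
qed

lemma one_minus_sqrt_lim_positive: "positive_op (\<lambda>x. x - sqrt_lim x)"
  unfolding positive_op_def
proof (intro conjI allI)
  show "bounded_clinear_op (\<lambda>x. x - sqrt_lim x)"
    by (intro bounded_clinear_op_diff bounded_clinear_op_id sqrt_lim_bounded_clinear)
  fix x
  have "(\<lambda>n. Im (cinner x (sqrt_iter B n x))) \<longlonglongrightarrow> Im (cinner x (sqrt_lim x))"
    by (intro tendsto_Im cinner.tendsto tendsto_const sqrt_lim)
  then have "Im (cinner x (sqrt_lim x)) = 0"
    by (simp add: positive_opD(2)[OF sqrt_iter_positive] LIMSEQ_const_iff)
  then show "Im (cinner x (x - sqrt_lim x)) = 0"
    by (simp add: cinner.diff_right cinner_self)
  have "Re (cinner x (sqrt_lim x)) \<le> norm x * norm x"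
    by (rule order_trans[OF Re_cinner_le]) (simp add: mult_left_mono sqrt_lim_le)
  then show "0 \<le> Re (cinner x (x - sqrt_lim x))"
    by (simp add: cinner.diff_right cinner_self power2_eq_square)
qed

end

text \<open>For a bound \<open>c\<close> of a positive \<open>A\<close>, the operator
  \<open>1 - A / c\<close> is a positive contraction, to which \<open>sqrt_lim\<close> applies.
  Keeping \<open>c\<close> explicit lets two operators share one scaling.\<close>

definition psqrt :: "real \<Rightarrow> ('a::chilbert_space \<Rightarrow> 'a) \<Rightarrow> 'a \<Rightarrow> 'a" where
  "psqrt c A x = sqrt c *\<^sub>R (x - sqrt_lim (\<lambda>y. y - (1 / c) *\<^sub>R A y) x)"

context
  fixes A :: "'a::chilbert_space \<Rightarrow> 'a" and c :: real
  assumes A: "positive_op A" and A_le: "\<And>x. norm (A x) \<le> norm x * c" and c: "c > 0"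
begin

text \<open>Expand the square; by \<open>positive_op_norm_sq_le\<close> the quadratic term is at
  most half of the subtracted linear term.\<close>

lemma complement_norm_le: "norm (y - (1 / c) *\<^sub>R A y) \<le> norm y"
proof (rule power2_le_imp_le)
  have "(norm (y - (1 / c) *\<^sub>R A y))\<^sup>2 =
      (norm y)\<^sup>2 - 2 / c * Re (cinner y (A y)) + (norm (A y))\<^sup>2 / c\<^sup>2"
    using c by (simp add: norm_diff_sq cinner_scaleR_right power_divide)
  also have "\<dots> \<le> (norm y)\<^sup>2 - 2 / c * Re (cinner y (A y)) + c * Re (cinner y (A y)) / c\<^sup>2"
    using positive_op_norm_sq_le[OF A A_le c] by (simp add: divide_right_mono)
  also have "\<dots> = (norm y)\<^sup>2 - Re (cinner y (A y)) / c"
    using c by (simp add: power2_eq_square)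
  also have "\<dots> \<le> (norm y)\<^sup>2" using c positive_opD(3)[OF A] by simp
  finally show "(norm (y - (1 / c) *\<^sub>R A y))\<^sup>2 \<le> (norm y)\<^sup>2" .
qed simp

lemma complement_positive: "positive_op (\<lambda>y. y - (1 / c) *\<^sub>R A y)"
  unfolding positive_op_def
proof (intro conjI allI)
  show "bounded_clinear_op (\<lambda>y. y - (1 / c) *\<^sub>R A y)"
    by (intro bounded_clinear_op_diff bounded_clinear_op_id bounded_clinear_op_scaleR positive_opD(1)[OF A])
  fix x
  show "Im (cinner x (x - (1 / c) *\<^sub>R A x)) = 0"
    by (simp add: cinner.diff_right cinner_self cinner_scaleR_right positive_opD(2)[OF A])
  have "Re (cinner x (A x)) \<le> norm x * norm (A x)" by (rule Re_cinner_le)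
  also have "\<dots> \<le> norm x * (norm x * c)" by (intro mult_left_mono A_le) simp
  finally show "0 \<le> Re (cinner x (x - (1 / c) *\<^sub>R A x))"
    using c by (simp add: cinner.diff_right cinner_self cinner_scaleR_right power2_eq_square field_simps)
qed

lemmas lim_rules = complement_positive complement_norm_le

lemma psqrt_positive: "positive_op (psqrt c A)"
  unfolding psqrt_def[abs_def]
  using c by (intro positive_op_scaleR one_minus_sqrt_lim_positive lim_rules) simp

lemma psqrt_psqrt: "psqrt c A (psqrt c A x) = A x"
proof -
  let ?Y = "sqrt_lim (\<lambda>y. y - (1 / c) *\<^sub>R A y)"
  interpret Y: bounded_linear ?Y
    by (rule bounded_clinear_opD[OF sqrt_lim_bounded_clinear[OF lim_rules]])
  have "psqrt c A (psqrt c A x) = c *\<^sub>R (x - ?Y x - (?Y x - ?Y (?Y x)))"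
    using c by (simp add: psqrt_def Y.scaleR Y.diff scaleR_diff_right)
  \<comment> \<open>By \<open>sqrt_lim_eq\<close>, \<open>1 - 2 Y + Y^2\<close> is
    \<open>1 - B\<close> with \<open>B = 1 - A / c\<close>.\<close>
  also have "\<dots> = c *\<^sub>R ((1 / c) *\<^sub>R A x)"
    by (rule arg_cong[where f = "scaleR c"])
      (simp add: sqrt_lim_eq[OF lim_rules] scaleR_2 algebra_simps)
  finally show ?thesis using c by simp
qed

end

text \<open>With a common \<open>c\<close> the two iterations intertwine term by term, and
  continuity of \<open>X\<close> passes this to the limits.\<close>

lemma psqrt_intertwine:
  assumes A1: "positive_op A1" "\<And>x. norm (A1 x) \<le> norm x * c"
    and A2: "positive_op A2" "\<And>x. norm (A2 x) \<le> norm x * c" and c: "c > 0"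
    and X: "bounded_linear X" and inter: "\<And>x. A1 (X x) = X (A2 x)"
  shows "psqrt c A1 (X x) = X (psqrt c A2 x)"
proof -
  interpret X: bounded_linear X by (rule X)
  let ?B1 = "\<lambda>y. y - (1 / c) *\<^sub>R A1 y" and ?B2 = "\<lambda>y. y - (1 / c) *\<^sub>R A2 y"
  have "(\<lambda>n. sqrt_iter ?B1 n (X x)) \<longlonglongrightarrow> sqrt_lim ?B1 (X x)"
    by (intro sqrt_lim complement_positive complement_norm_le A1 c)
  moreover have "sqrt_iter ?B1 n (X x) = X (sqrt_iter ?B2 n x)" for n
    by (rule sqrt_iter_intertwine[OF X]) (simp add: inter X.diff X.scaleR)
  moreover have "(\<lambda>n. X (sqrt_iter ?B2 n x)) \<longlonglongrightarrow> X (sqrt_lim ?B2 x)"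
    by (intro X.tendsto sqrt_lim complement_positive complement_norm_le A2 c)
  ultimately have "sqrt_lim ?B1 (X x) = X (sqrt_lim ?B2 x)"
    using LIMSEQ_unique by auto
  then show ?thesis by (simp add: psqrt_def X.diff X.scaleR)
qed

text \<open>\<open>P\<close> commutes with \<open>A\<close>, hence with \<open>?Q\<close>, so
  \<open>P + ?Q\<close> kills \<open>y = P x - ?Q x\<close>. Both forms then vanish at
  \<open>y\<close>, so \<open>P\<close> and \<open>?Q\<close> kill \<open>y\<close> separately, and
  self-adjointness gives \<open>cinner y y = 0\<close>.\<close>

lemma psqrt_unique:
  assumes A: "positive_op A" "\<And>x. norm (A x) \<le> norm x * c" and c: "c > 0"
    and P: "positive_op P" "\<And>x. P (P x) = A x"
  shows "P = psqrt c A"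
proof
  fix x
  let ?Q = "psqrt c A"
  have Q: "positive_op ?Q" and QQ: "\<And>x. ?Q (?Q x) = A x"
    using psqrt_positive[OF A c] psqrt_psqrt[OF A c] by auto
  interpret P: bounded_linear P by (rule bounded_clinear_opD[OF positive_opD(1)[OF P(1)]])
  interpret Q: bounded_linear ?Q by (rule bounded_clinear_opD[OF positive_opD(1)[OF Q]])
  have comm: "?Q (P x) = P (?Q x)" for x
    by (rule psqrt_intertwine[OF A A c P.bounded_linear]) (simp add: P(2)[symmetric])
  define y where "y = P x - ?Q x"
  have "P y + ?Q y = 0"
    by (simp add: y_def P.diff Q.diff comm P(2) QQ)
  then have "Re (cinner y (P y)) + Re (cinner y (?Q y)) = 0"
    by (metis cinner_add_right plus_complex.sel(1) cinner.zero_right zero_complex.sel(1))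
  then have "Re (cinner y (P y)) = 0" "Re (cinner y (?Q y)) = 0"
    using positive_opD(3)[OF P(1), of y] positive_opD(3)[OF Q, of y] by linarith+
  then have 0: "P y = 0" "?Q y = 0" using positive_op_null P(1) Q by blast+
  have "cinner y y = cinner x (P y) - cinner x (?Q y)"
    by (subst (1) y_def) (simp add: cinner.diff_left positive_op_selfadjoint[OF P(1)]
        positive_op_selfadjoint[OF Q])
  then have "y = 0" by (simp add: 0 cinner.zero_right cinner_self_eq_zero)
  then show "P x = ?Q x" by (simp add: y_def)
qed

section \<open>Quasinormal operators and minimal normal extensions\<close>

lemma adjoint_product_positive:
  fixes T :: "'a::chilbert_space \<Rightarrow> 'b::chilbert_space"
  assumes T: "bounded_clinear_op T"
  shows "positive_op (cadjoint T \<circ> T)"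
  using bounded_clinear_op_compose[OF cadjoint_bounded_clinear[OF T] T]
  by (simp add: positive_op_def o_def cadjoint_works[OF T, symmetric] cinner_self)

text \<open>Existence and uniqueness of the positive root resolve the definite description; every
  admissible \<open>c\<close> yields the same operator.\<close>

lemma abs_op_eq_psqrt:
  fixes T :: "'a::chilbert_space \<Rightarrow> 'b::chilbert_space"
  assumes T: "bounded_clinear_op T"
    and c: "\<And>x. norm ((cadjoint T \<circ> T) x) \<le> norm x * c" "c > 0"
  shows "abs_op T = psqrt c (cadjoint T \<circ> T)"
  unfolding abs_op_def
proof (rule the_equality)
  note A = adjoint_product_positive[OF T]
  show "positive_op (psqrt c (cadjoint T \<circ> T)) \<and>
      psqrt c (cadjoint T \<circ> T) \<circ> psqrt c (cadjoint T \<circ> T) = cadjoint T \<circ> T"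
    by (intro conjI ext psqrt_positive[OF A c]) (simp only: o_apply psqrt_psqrt[OF A c])
  show "P = psqrt c (cadjoint T \<circ> T)" if "positive_op P \<and> P \<circ> P = cadjoint T \<circ> T" for P
    using that by (intro psqrt_unique[OF A c]) (auto simp: fun_eq_iff)
qed

lemma bounded_clinear_op_pos_bound:
  assumes "bounded_clinear_op f"
  obtains c where "c > 0" "\<And>x. norm (f x) \<le> norm x * c"
  using bounded_linear.pos_bounded[OF bounded_clinear_opD(1)[OF assms]] by blast

lemma abs_op_works:
  fixes T :: "'a::chilbert_space \<Rightarrow> 'b::chilbert_space"
  assumes T: "bounded_clinear_op T"
  shows "positive_op (abs_op T)" "abs_op T (abs_op T x) = cadjoint T (T x)"
proof -
  note A = adjoint_product_positive[OF T]
  obtain c where c: "c > 0" "\<And>x. norm ((cadjoint T \<circ> T) x) \<le> norm x * c"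
    using bounded_clinear_op_pos_bound[OF positive_opD(1)[OF A]] by metis
  show "positive_op (abs_op T)"
    unfolding abs_op_eq_psqrt[OF T c(2,1)] by (rule psqrt_positive[OF A c(2,1)])
  show "abs_op T (abs_op T x) = cadjoint T (T x)"
    unfolding abs_op_eq_psqrt[OF T c(2,1)] psqrt_psqrt[OF A c(2,1)] by simp
qed

lemma abs_op_intertwine:
  fixes T1 :: "'a::chilbert_space \<Rightarrow> 'b::chilbert_space" and T2 :: "'c::chilbert_space \<Rightarrow> 'd::chilbert_space"
  assumes T1: "bounded_clinear_op T1" and T2: "bounded_clinear_op T2" and X: "bounded_clinear_op X"
    and inter: "\<And>x. cadjoint T1 (T1 (X x)) = X (cadjoint T2 (T2 x))"
  shows "abs_op T1 (X x) = X (abs_op T2 x)"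
proof -
  note A1 = adjoint_product_positive[OF T1] and A2 = adjoint_product_positive[OF T2]
  obtain c1 where c1: "c1 > 0" "\<And>x. norm ((cadjoint T1 \<circ> T1) x) \<le> norm x * c1"
    using bounded_clinear_op_pos_bound[OF positive_opD(1)[OF A1]] by metis
  obtain c2 where c2: "c2 > 0" "\<And>x. norm ((cadjoint T2 \<circ> T2) x) \<le> norm x * c2"
    using bounded_clinear_op_pos_bound[OF positive_opD(1)[OF A2]] by metis
  \<comment> \<open>\<open>psqrt_intertwine\<close> asks for one scaling constant on both sides,
    hence the sum of the bounds.\<close>
  have c: "c1 + c2 > 0" "norm ((cadjoint T1 \<circ> T1) x) \<le> norm x * (c1 + c2)"
    "norm ((cadjoint T2 \<circ> T2) y) \<le> norm y * (c1 + c2)" for x y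
    using c1(1) c2(1) order_trans[OF c1(2), of x "norm x * (c1 + c2)"]
      order_trans[OF c2(2), of y "norm y * (c1 + c2)"]
    by (simp_all add: mult_left_mono)
  show ?thesis
    unfolding abs_op_eq_psqrt[OF T1 c(2,1)] abs_op_eq_psqrt[OF T2 c(3,1)]
    by (rule psqrt_intertwine[OF A1 c(2) A2 c(3,1) bounded_clinear_opD(1)[OF X]]) (simp add: inter)
qed

text \<open>Passing to the adjoint of \<open>D\<close> avoids the orthogonal projection theorem.\<close>

lemma zero_on_selfadjoint_range:
  fixes D :: "'a::chilbert_space \<Rightarrow> 'b::chilbert_space"
  assumes D: "bounded_clinear_op D" and self: "\<And>x y. cinner (P x) y = cinner x (P y)"
    and inj: "\<And>x. P x = 0 \<Longrightarrow> x = 0" and DP: "\<And>x. D (P x) = 0"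
  shows "D x = 0"
proof -
  \<comment> \<open>Taking adjoints turns \<open>D (P x) = 0\<close> into this, where injectivity of
    \<open>P\<close> can act.\<close>
  have "P (cadjoint D y) = 0" for y
    by (rule cinner_right_ext)
      (simp add: self[symmetric] cadjoint_works[OF D, symmetric] DP cinner.zero_left cinner.zero_right)
  then have "cadjoint D y = 0" for y by (rule inj)
  then show ?thesis
    by (intro cinner_eq_zero_all) (simp add: cadjoint_works[OF D] cinner.zero_right)
qed

lemma isometric_cinner:
  assumes V: "bounded_clinear_op V" and iso: "\<And>x. norm (V x) = norm x"
  shows "cinner (V x) (V y) = cinner x y"
proof -
  interpret V: bounded_linear V by (rule bounded_clinear_opD[OF V])
  have re: "Re (cinner (V x) (V y)) = Re (cinner x y)" for x y
    using norm_add_sq[of "V x" "V y"] norm_add_sq[of x y]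
    by (simp add: V.add[symmetric] iso)
  have "Im (cinner (V x) (V y)) = Im (cinner x y)"
    using re[of x "scaleC \<i> y"]
    by (simp add: bounded_clinear_opD(2)[OF V] cinner_scaleC_right)
  then show ?thesis using re[of x y] by (simp add: complex_eq_iff)
qed

lemma injective_quasinormal_polar:
  fixes T :: "'a::chilbert_space \<Rightarrow> 'a"
  assumes q: "quasinormal T" and i: "inj T" and p: "polar_decomposition V T"
  shows "bounded_clinear_op T" "bounded_clinear_op V" "T x = V (abs_op T x)"
    "V (abs_op T x) = abs_op T (V x)" "abs_op T x = 0 \<Longrightarrow> x = 0"
    "cinner (V x) (V y) = cinner x y" "T (cadjoint T (T x)) = cadjoint T (T (T x))"
proof -
  let ?P = "abs_op T"
  show T: "bounded_clinear_op T" and V: "bounded_clinear_op V"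
    using q p by (auto simp: quasinormal_def polar_decomposition_def partial_isometry_def)
  interpret T: bounded_linear T by (rule bounded_clinear_opD[OF T])
  interpret V: bounded_linear V by (rule bounded_clinear_opD[OF V])
  note P = abs_op_works(1)[OF T]
  have TP: "T (?P x) = ?P (T x)" for x using q by (auto simp: quasinormal_def fun_eq_iff)
  have TVP: "T x = V (?P x)" for x using p unfolding polar_decomposition_def by (metis o_apply)
  then show "T x = V (?P x)" .
  have T0: "x = 0" if "T x = 0" for x using i that by (metis T.zero injD)
  show P0: "x = 0" if "?P x = 0" for x using that T0 TVP V.zero by simp
  have "V x = 0 \<longleftrightarrow> T x = 0" for x
    using p unfolding polar_decomposition_def by blast
  \<comment> \<open>Injectivity of \<open>T\<close> makes the kernel of \<open>V\<close> trivial, so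
    every vector is orthogonal to it.\<close>
  then have "norm (V x) = norm x" for x
    using p T0 cinner.zero_left unfolding polar_decomposition_def partial_isometry_def by metis
  then show "cinner (V x) (V y) = cinner x y" by (rule isometric_cinner[OF V])
  \<comment> \<open>At \<open>?P x\<close> in place of \<open>x\<close> this is quasinormality, and
    an operator vanishing on the range of the injective self-adjoint \<open>?P\<close> is
    zero.\<close>
  have "V (?P x) - ?P (V x) = 0"
  proof (rule zero_on_selfadjoint_range[where D = "\<lambda>x. V (?P x) - ?P (V x)" and P = ?P])
    show "bounded_clinear_op (\<lambda>x. V (?P x) - ?P (V x))"
      by (rule bounded_clinear_op_diff[OF bounded_clinear_op_compose[OF V positive_opD(1)[OF P]]
            bounded_clinear_op_compose[OF positive_opD(1)[OF P] V]])
    show "cinner (?P x) y = cinner x (?P y)" for x y by (rule positive_op_selfadjoint[OF P])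
    show "V (?P (?P x)) - ?P (V (?P x)) = 0" for x using TP[of x] by (simp add: TVP[symmetric])
  qed (rule P0)
  then show "V (?P x) = ?P (V x)" by simp
  \<comment> \<open>\<open>cadjoint T \<circ> T\<close> is the square of \<open>?P\<close>, with
    which \<open>T\<close> commutes.\<close>
  show "T (cadjoint T (T x)) = cadjoint T (T (T x))"
    by (simp add: abs_op_works(2)[OF T, symmetric] TP)
qed

text \<open>\<open>G\<close> is the graph of a partial map whose single-valuedness need not be shown
  beforehand: the bound, applied to differences, forces it for \<open>G\<close> and for its closure
  \<open>R\<close>. Density and completeness make \<open>R\<close> total.\<close>

lemma bounded_extension:
  fixes G :: "('a::chilbert_space \<times> 'b::chilbert_space) set"
  assumes add: "\<And>y z y' z'. (y, z) \<in> G \<Longrightarrow> (y', z') \<in> G \<Longrightarrow> (y + y', z + z') \<in> G"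
    and sc: "\<And>c y z. (y, z) \<in> G \<Longrightarrow> (scaleC c y, scaleC c z) \<in> G"
    and bd: "\<And>y z. (y, z) \<in> G \<Longrightarrow> norm z \<le> norm y * K"
    and dense: "closure (fst ` G) = UNIV"
  obtains f where "bounded_clinear_op f" "\<And>y z. (y, z) \<in> G \<Longrightarrow> f y = z"
proof -
  define R where "R y z \<longleftrightarrow> (\<exists>s t. (\<forall>n::nat. (s n, t n) \<in> G) \<and> s \<longlonglongrightarrow> y \<and> t \<longlonglongrightarrow> z)" for y z
  have RI: "R y z" if "\<And>n::nat. (s n, t n) \<in> G" "s \<longlonglongrightarrow> y" "t \<longlonglongrightarrow> z" for s t y z
    unfolding R_def using that by blast
  have RE: "\<exists>s t. (\<forall>n::nat. (s n, t n) \<in> G) \<and> s \<longlonglongrightarrow> y \<and> t \<longlonglongrightarrow> z" if "R y z" for y z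
    using that unfolding R_def .
  have R_G: "R y z" if "(y, z) \<in> G" for y z
    by (rule RI[of "\<lambda>_. y" "\<lambda>_. z"]) (simp_all add: that)
  have R_add: "R (y + y') (z + z')" if yz: "R y z" "R y' z'" for y z y' z'
  proof -
    obtain s t s' t' where "\<forall>n::nat. (s n, t n) \<in> G" "s \<longlonglongrightarrow> y" "t \<longlonglongrightarrow> z"
      "\<forall>n::nat. (s' n, t' n) \<in> G" "s' \<longlonglongrightarrow> y'" "t' \<longlonglongrightarrow> z'"
      using RE[OF yz(1)] RE[OF yz(2)] by blast
    then show ?thesis
      by (intro RI[of "\<lambda>n. s n + s' n" "\<lambda>n. t n + t' n"] tendsto_add add) auto
  qed
  have R_sc: "R (scaleC c y) (scaleC c z)" if yz: "R y z" for c y z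
  proof -
    obtain s t where "\<forall>n::nat. (s n, t n) \<in> G" "s \<longlonglongrightarrow> y" "t \<longlonglongrightarrow> z"
      using RE[OF yz] by blast
    then show ?thesis
      by (intro RI[of "\<lambda>n. scaleC c (s n)" "\<lambda>n. scaleC c (t n)"]
          bounded_linear.tendsto[OF bounded_linear_scaleC] sc) auto
  qed
  have R_bd: "norm z \<le> norm y * K" if yz: "R y z" for y z
  proof -
    obtain s t where st: "\<forall>n::nat. (s n, t n) \<in> G" "s \<longlonglongrightarrow> y" "t \<longlonglongrightarrow> z"
      using RE[OF yz] by blast
    have "(\<lambda>n. norm (t n)) \<longlonglongrightarrow> norm z" "(\<lambda>n. norm (s n) * K) \<longlonglongrightarrow> norm y * K"
      by (intro tendsto_intros st)+
    then show ?thesis by (rule LIMSEQ_le) (use st bd in auto)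
  qed
  have R_unique: "z = z'" if "R y z" "R y z'" for y z z'
  proof -
    have "R (y + scaleC (-1) y) (z + scaleC (-1) z')" by (intro R_add R_sc that)
    then have "R 0 (z - z')" by (simp add: scaleC_minus1)
    from R_bd[OF this] show ?thesis by simp
  qed
  have R_total: "\<exists>z. R y z" for y
  proof -
    have "y \<in> closure (fst ` G)" by (simp add: dense)
    then obtain s where s: "\<forall>n::nat. s n \<in> fst ` G" "s \<longlonglongrightarrow> y"
      unfolding closure_sequential by blast
    then have "\<forall>n. \<exists>t. (s n, t) \<in> G" by force
    then obtain t where t: "\<And>n. (s n, t n) \<in> G" by metis
    have diff: "norm (t m - t n) \<le> norm (s m - s n) * \<bar>K\<bar>" for m n
    proof -
      have "(s m + scaleC (-1) (s n), t m + scaleC (-1) (t n)) \<in> G" by (intro add sc t)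
      from bd[OF this] have "norm (t m - t n) \<le> norm (s m - s n) * K"
        by (simp add: scaleC_minus1)
      also have "\<dots> \<le> norm (s m - s n) * \<bar>K\<bar>" by (simp add: mult_left_mono)
      finally show ?thesis .
    qed
    have "Cauchy s" using s(2) by (rule LIMSEQ_imp_Cauchy)
    have "Cauchy t"
    proof (rule CauchyI)
      fix e :: real assume e: "0 < e"
      \<comment> \<open>No sign of \<open>K\<close> is assumed; \<open>\<bar>K\<bar> + 1\<close> is
        a positive divisor in every case.\<close>
      then obtain M where M: "\<And>m n. m \<ge> M \<Longrightarrow> n \<ge> M \<Longrightarrow> norm (s m - s n) < e / (\<bar>K\<bar> + 1)"
        using CauchyD[OF \<open>Cauchy s\<close>, of "e / (\<bar>K\<bar> + 1)"] by (auto simp: add_nonneg_pos)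
      have "norm (t m - t n) < e" if "m \<ge> M" "n \<ge> M" for m n
      proof -
        have "norm (t m - t n) \<le> norm (s m - s n) * (\<bar>K\<bar> + 1)"
          using diff[of m n] norm_ge_zero[of "s m - s n"] by (simp add: distrib_left del: norm_ge_zero)
        also have "\<dots> < e" using M[OF that] by (simp add: pos_less_divide_eq add_nonneg_pos)
        finally show ?thesis .
      qed
      then show "\<exists>M. \<forall>m\<ge>M. \<forall>n\<ge>M. norm (t m - t n) < e" by blast
    qed
    then obtain z where "t \<longlonglongrightarrow> z" using Cauchy_convergent_iff convergent_def by blast
    then show ?thesis using RI[OF t s(2)] by blast
  qed
  then obtain f where f: "\<And>y. R y (f y)" by metis
  have f_eq: "f y = z" if "R y z" for y z using R_unique[OF f that] .
  show thesis
  proof (rule that)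
    show "bounded_clinear_op f" unfolding bounded_clinear_op_def clinear_op_def
      by (intro conjI allI exI[of _ K] f_eq R_add R_sc R_bd f)
    show "f y = z" if "(y, z) \<in> G" for y z by (rule f_eq[OF R_G[OF that]])
  qed
qed

lemma closed_csubspace_closure:
  fixes S :: "'a::complex_inner set"
  assumes 0: "0 \<in> S" and add: "\<And>x y. x \<in> S \<Longrightarrow> y \<in> S \<Longrightarrow> x + y \<in> S"
    and sc: "\<And>c x. x \<in> S \<Longrightarrow> scaleC c x \<in> S"
  shows "closed_csubspace (closure S)"
  unfolding closed_csubspace_def
proof (intro conjI ballI allI)
  show "0 \<in> closure S" using 0 closure_subset by blast
  show "x + y \<in> closure S" if xy: "x \<in> closure S" "y \<in> closure S" for x y
  proof -
    obtain s t where "\<forall>n::nat. s n \<in> S" "s \<longlonglongrightarrow> x" "\<forall>n::nat. t n \<in> S" "t \<longlonglongrightarrow> y"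
      using xy unfolding closure_sequential by blast
    then show ?thesis unfolding closure_sequential
      by (intro exI[of _ "\<lambda>n. s n + t n"]) (auto intro: tendsto_add add)
  qed
  show "scaleC c x \<in> closure S" if x: "x \<in> closure S" for c x
    using image_closure_subset[of S "scaleC c" "closure S"] sc closure_subset that
      linear_continuous_on[OF bounded_linear_scaleC[of c], of "closure S"]
    by blast
qed simp

section \<open>A single minimal normal extension: a dense subspace and its norm\<close>

locale normal_extension =
  fixes T V :: "'h::chilbert_space \<Rightarrow> 'h" and N :: "'k::chilbert_space \<Rightarrow> 'k" and U :: "'h \<Rightarrow> 'k"
  assumes quasi: "quasinormal T" and inj_T: "inj T" and polar: "polar_decomposition V T"
    and ext: "minimal_normal_extension N U T"
begin

abbreviation "P \<equiv> abs_op T"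
abbreviation "M \<equiv> cadjoint N"

lemmas T = injective_quasinormal_polar(1)[OF quasi inj_T polar]
lemmas V = injective_quasinormal_polar(2)[OF quasi inj_T polar]
lemmas T_eq = injective_quasinormal_polar(3)[OF quasi inj_T polar]
lemmas VP = injective_quasinormal_polar(4)[OF quasi inj_T polar]
lemmas P_inj = injective_quasinormal_polar(5)[OF quasi inj_T polar]
lemmas V_iso = injective_quasinormal_polar(6)[OF quasi inj_T polar]
lemmas TTT = injective_quasinormal_polar(7)[OF quasi inj_T polar]
lemmas P = abs_op_works(1)[OF T]
lemmas P_self = positive_op_selfadjoint[OF P]

lemma N: "bounded_clinear_op N" and NM: "N (M z) = M (N z)" and NU: "N (U x) = U (T x)"
  and U: "bounded_clinear_op U" and U_iso: "cinner (U x) (U y) = cinner x y"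
  using ext by (auto simp: minimal_normal_extension_def normal_op_def isometric_embedding_def fun_eq_iff)

lemmas N_adj = cadjoint_works[OF N]

lemma M: "bounded_clinear_op M"
  by (rule cadjoint_bounded_clinear[OF N])

lemma minimal: "reducing_subspace N S \<Longrightarrow> range U \<subseteq> S \<Longrightarrow> S = UNIV"
  using ext unfolding minimal_normal_extension_def by blast

text \<open>By quasinormality all inner products in the expansion of \<open>\<parallel>M N U x - U T\<^sup>* T x\<parallel>\<^sup>2\<close> are equal.\<close>

lemma MN_U: "M (N (U x)) = U (cadjoint T (T x))"
proof -
  let ?S = "cadjoint T"
  define a where "a = cinner (?S (T x)) (?S (T x))"
  have 1: "cinner (M (N (U x))) (M (N (U x))) = a"
  proof -
    have "cinner (M (N (U x))) (M (N (U x))) = cinner (N (N (U x))) (N (N (U x)))"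
      by (metis N_adj NM adjoint_swap)
    also have "\<dots> = cinner (T (T x)) (T (T x))" by (simp add: NU U_iso)
    also have "\<dots> = cinner (T x) (T (?S (T x)))" by (simp add: cadjoint_works[OF T] TTT)
    also have "\<dots> = a" by (metis adjoint_swap[OF cadjoint_works[OF T]] a_def)
    finally show ?thesis .
  qed
  have 2: "cinner (M (N (U x))) (U (?S (T x))) = a"
  proof -
    have "cinner (M (N (U x))) (U (?S (T x))) = cinner (U (T x)) (U (T (?S (T x))))"
      by (simp add: adjoint_swap[OF N_adj] NU)
    also have "\<dots> = a" by (simp add: U_iso a_def adjoint_swap[OF cadjoint_works[OF T]])
    finally show ?thesis .
  qed
  have a: "cnj a = a" unfolding a_def by (metis cinner_commute)
  have 3: "cinner (U (?S (T x))) (M (N (U x))) = a" by (metis 2 a cinner_commute)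
  have "cinner (M (N (U x)) - U (?S (T x))) (M (N (U x)) - U (?S (T x))) = 0"
    by (simp add: cinner.diff_left cinner.diff_right 1 2 3 U_iso a_def[symmetric])
  then show ?thesis by (simp add: cinner_self_eq_zero)
qed

text \<open>Only powers of \<open>M\<close> occur, because \<open>N\<close> commutes with them and
  acts on \<open>range U\<close> as \<open>T\<close>. Entries of \<open>x\<close> from index
  \<open>m\<close> on are ignored.\<close>

definition combination :: "nat \<Rightarrow> (nat \<Rightarrow> 'h) \<Rightarrow> 'k" where
  "combination m x = (\<Sum>k<m. (M ^^ k) (U (x k)))"

text \<open>If \<open>W\<close> denotes the unitary part of \<open>N\<close>, then \<open>U (model m x)\<close> is \<open>W\<^sup>2\<^sup>m\<close> applied to
  \<open>combination m x\<close>.\<close>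

definition model :: "nat \<Rightarrow> (nat \<Rightarrow> 'h) \<Rightarrow> 'h" where
  "model m x = (\<Sum>k<m. (V ^^ (2 * m - k)) ((P ^^ k) (x k)))"

lemma cinner_V_funpow: "cinner ((V ^^ n) x) ((V ^^ n) y) = cinner x y"
  by (induction n) (simp_all add: V_iso)

lemma T_funpow: "(T ^^ n) x = (V ^^ n) ((P ^^ n) x)"
proof (induction n)
  case (Suc n)
  have "P ((V ^^ n) y) = (V ^^ n) (P y)" for y
    by (rule funpow_commute) (simp add: VP)
  moreover have "(T ^^ Suc n) x = V (P ((T ^^ n) x))"
    by (simp only: funpow.simps o_apply T_eq[symmetric])
  ultimately show ?case by (simp add: Suc)
qed simp

lemma P_funpow_V_funpow: "(P ^^ j) ((V ^^ k) x) = (V ^^ k) ((P ^^ j) x)"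
  by (rule funpow_commute) (rule funpow_commute[of V P P, OF VP, symmetric])

text \<open>Move each power of \<open>M\<close> to the other side as a power of \<open>N\<close>,
  which normality lets pass the remaining \<open>M\<close>; on \<open>range U\<close> powers of
  \<open>N\<close> are powers of \<open>T\<close>.\<close>

lemma cinner_M_funpow:
  "cinner ((M ^^ k) (U x)) ((M ^^ j) (U y)) = cinner ((T ^^ j) x) ((T ^^ k) y)"
proof -
  have U_pow: "(N ^^ n) (U x) = U ((T ^^ n) x)" for n x
    using funpow_commute[of U T N n x] NU by simp
  have comm: "(N ^^ j) ((M ^^ k) x) = (M ^^ k) ((N ^^ j) x)" for x
    by (rule funpow_commute) (metis NM funpow_commute)
  have "cinner ((M ^^ k) (U x)) ((M ^^ j) (U y)) = cinner ((N ^^ j) ((M ^^ k) (U x))) (U y)"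
    by (simp add: adjoint_funpow[OF N_adj])
  also have "\<dots> = cinner ((N ^^ j) (U x)) ((N ^^ k) (U y))"
    by (simp add: comm adjoint_funpow[OF adjoint_swap[OF N_adj]])
  finally show ?thesis by (simp add: U_pow U_iso)
qed

text \<open>The summands of the two sums have the same pairwise inner products.\<close>

lemma norm_combination: "norm (combination m x) = norm (model m x)"
proof -
  have "cinner ((T ^^ j) a) ((T ^^ k) b) =
      cinner ((V ^^ (2 * m - k)) ((P ^^ k) a)) ((V ^^ (2 * m - j)) ((P ^^ j) b))"
    if "j < m" "k < m" for j k a b
  proof -
    \<comment> \<open>As \<open>j, k < m\<close>, both exponents \<open>2 * m - k\<close> and
      \<open>2 * m - j\<close> contain the common part \<open>n\<close>, which the isometry
      \<open>V ^^ n\<close> absorbs.\<close>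
    define n where "n = 2 * m - j - k"
    have n: "2 * m - k = n + j" "2 * m - j = n + k" using that by (auto simp: n_def)
    note self = adjoint_funpow[OF P_self]
    have comm: "(P ^^ j) ((P ^^ k) y) = (P ^^ k) ((P ^^ j) y)" for y
      by (metis add.commute funpow_add o_apply)
    have "cinner ((T ^^ j) a) ((T ^^ k) b) = cinner ((V ^^ j) ((P ^^ j) a)) ((V ^^ k) ((P ^^ k) b))"
      by (simp add: T_funpow)
    \<comment> \<open>Powers of \<open>P\<close> are self-adjoint and commute with each other and
      with \<open>V\<close>, so \<open>P ^^ j\<close> and \<open>P ^^ k\<close> can trade
      sides.\<close>
    also have "\<dots> = cinner ((V ^^ j) ((P ^^ k) a)) ((V ^^ k) ((P ^^ j) b))"
      by (simp add: P_funpow_V_funpow[symmetric] self) (simp add: self[symmetric] comm)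
    also have "\<dots> = cinner ((V ^^ n) ((V ^^ j) ((P ^^ k) a))) ((V ^^ n) ((V ^^ k) ((P ^^ j) b)))"
      by (simp add: cinner_V_funpow)
    finally show ?thesis by (simp add: n funpow_add)
  qed
  then have "cinner (combination m x) (combination m x) = cinner (model m x) (model m x)"
    unfolding combination_def model_def
    by (simp add: cinner.sum_left cinner.sum_right cinner_M_funpow)
  then show ?thesis by (simp add: norm_eq_sqrt_cinner)
qed

text \<open>Zero padding brings combinations to a common length, so that they can be added.\<close>

lemma combination_pad:
  "m \<le> n \<Longrightarrow> combination n (\<lambda>k. if k < m then x k else 0) = combination m x"
proof -
  assume "m \<le> n"
  have "U 0 = 0" "(M ^^ k) 0 = 0" for k
    using bounded_clinear_opD(1)[OF U] bounded_clinear_opD(1)[OF bounded_clinear_op_funpow[OF M]]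
    by (auto intro: linear_0 bounded_linear.linear)
  then show ?thesis unfolding combination_def using \<open>m \<le> n\<close>
    by (intro sum.mono_neutral_cong_right) auto
qed

lemma combination_add:
  "combination m (\<lambda>k. x k + y k) = combination m x + combination m y"
  using bounded_clinear_opD(1)[OF U] bounded_clinear_opD(1)[OF bounded_clinear_op_funpow[OF M]]
  by (simp add: combination_def sum.distrib linear_add bounded_linear.linear)

lemma combination_scaleC:
  "combination m (\<lambda>k. scaleC c (x k)) = scaleC c (combination m x)"
  by (simp add: combination_def bounded_clinear_opD(2)[OF U]
      bounded_clinear_opD(2)[OF bounded_clinear_op_funpow[OF M]]
      linear_sum[OF bounded_linear.linear[OF bounded_linear_scaleC]])

lemma combination_single: "combination 1 (\<lambda>_. x) = U x"
  by (simp add: combination_def)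

lemma N_combination: "N (combination m x) = combination m (\<lambda>k. T (x k))"
  by (simp add: combination_def linear_sum[OF bounded_linear.linear[OF bounded_clinear_opD(1)[OF N]]]
      funpow_commute[of N M M, OF NM] NU)

lemma M_combination:
  "M (combination m x) = combination (Suc m) (\<lambda>k. case k of 0 \<Rightarrow> 0 | Suc k \<Rightarrow> x k)"
  using linear_0[OF bounded_linear.linear[OF bounded_clinear_opD(1)[OF U]]]
  by (simp add: combination_def linear_sum[OF bounded_linear.linear[OF bounded_clinear_opD(1)[OF M]]]
      sum.lessThan_Suc_shift del: sum.lessThan_Suc)

text \<open>The closure is a subspace invariant under \<open>N\<close> and \<open>M\<close> and
  contains \<open>range U\<close>, so minimality applies.\<close>

lemma combinations_dense: "closure {combination m x | m x. True} = UNIV"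
proof -
  let ?S = "{combination m x | m x. True}"
  have img: "f ` closure ?S \<subseteq> closure ?S" if "bounded_clinear_op f" "\<And>m x. f (combination m x) \<in> ?S" for f
    using that closure_subset[of ?S]
    by (intro image_closure_subset linear_continuous_on bounded_clinear_opD(1)) auto
  have "closed_csubspace (closure ?S)"
  proof (rule closed_csubspace_closure)
    have "combination 0 (\<lambda>_. 0) = 0" by (simp add: combination_def)
    then show "0 \<in> ?S" by force
    fix a b assume "a \<in> ?S" "b \<in> ?S"
    then obtain m x n y where ab: "a = combination m x" "b = combination n y" by blast
    have "a + b = combination (max m n)
        (\<lambda>k. (if k < m then x k else 0) + (if k < n then y k else 0))"
      by (simp add: combination_add combination_pad ab)
    then show "a + b \<in> ?S" by blast
  next
    fix c a assume "a \<in> ?S"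
    then obtain m x where "a = combination m x" by blast
    then have "scaleC c a = combination m (\<lambda>k. scaleC c (x k))" by (simp add: combination_scaleC)
    then show "scaleC c a \<in> ?S" by blast
  qed
  moreover have "N ` closure ?S \<subseteq> closure ?S"
    by (rule img[OF N]) (auto simp: N_combination)
  moreover have "M ` closure ?S \<subseteq> closure ?S"
    by (rule img[OF M]) (auto simp: M_combination)
  moreover have "range U \<subseteq> closure ?S"
  proof
    fix z assume "z \<in> range U"
    then obtain x where "z = U x" by blast
    then have "z = combination 1 (\<lambda>_. x)" by (simp only: combination_single)
    then have "z \<in> ?S" by blast
    then show "z \<in> closure ?S" by (rule subsetD[OF closure_subset])
  qed
  ultimately show ?thesis by (intro minimal) (auto simp: reducing_subspace_def)
qed

end

section \<open>Two minimal normal extensions and an operator between the original spaces\<close>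

locale normal_extension_pair =
  E1: normal_extension T1 V1 N1 U1 + E2: normal_extension T2 V2 N2 U2
  for T1 V1 :: "'h1::chilbert_space \<Rightarrow> 'h1" and N1 :: "'k1::chilbert_space \<Rightarrow> 'k1" and U1
    and T2 V2 :: "'h2::chilbert_space \<Rightarrow> 'h2" and N2 :: "'k2::chilbert_space \<Rightarrow> 'k2" and U2 +
  fixes X :: "'h2 \<Rightarrow> 'h1"
  assumes X: "bounded_clinear_op X"
begin

lemma intertwines_adjoints:
  assumes Y: "bounded_clinear_op Y" and "N1 \<circ> Y = Y \<circ> N2"
  shows "E1.M (Y x) = Y (E2.M x)"
  using assms(2)
  by (intro fuglede_putnam[OF E1.N E1.N_adj E1.NM E2.N E2.N_adj E2.NM Y]) (simp add: fun_eq_iff)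

lemma extension_imp_intertwines:
  assumes Y: "bounded_clinear_op Y" and YU: "Y \<circ> U2 = U1 \<circ> X" and NY: "N1 \<circ> Y = Y \<circ> N2"
  shows "V1 (X x) = X (V2 x)" and "abs_op T1 (X x) = X (abs_op T2 x)"
proof -
  have YU': "Y (U2 x) = U1 (X x)" and NY': "N1 (Y z) = Y (N2 z)" for x z
    using YU NY by (auto simp: fun_eq_iff)
  \<comment> \<open>Identities in the smaller space can therefore be checked after embedding, where
    \<open>Y\<close> and the normal operators act.\<close>
  have U1_inj: "a = b" if "U1 a = U1 b" for a b
    using that by (intro cinner_right_ext) (metis E1.U_iso)
  have TX: "T1 (X x) = X (T2 x)" for x
    by (rule U1_inj) (simp add: E1.NU[symmetric] YU'[symmetric] NY' E2.NU)
  have "cadjoint T1 (T1 (X x)) = X (cadjoint T2 (T2 x))" for x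
    by (rule U1_inj) (simp add: E1.MN_U[symmetric] YU'[symmetric] NY' E2.MN_U
        intertwines_adjoints[OF Y NY])
  then show PX: "abs_op T1 (X x) = X (abs_op T2 x)" for x
    by (rule abs_op_intertwine[OF E1.T E2.T X])
  \<comment> \<open>At \<open>abs_op T2 x\<close> the difference becomes
    \<open>T1 (X x) - X (T2 x)\<close> by \<open>PX\<close>, so it vanishes on the range of
    \<open>abs_op T2\<close>.\<close>
  have "V1 (X x) - X (V2 x) = 0"
  proof (rule zero_on_selfadjoint_range[where D = "\<lambda>x. V1 (X x) - X (V2 x)",
        OF _ E2.P_self E2.P_inj])
    show "bounded_clinear_op (\<lambda>x. V1 (X x) - X (V2 x))"
      by (rule bounded_clinear_op_diff[OF bounded_clinear_op_compose[OF E1.V X]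
            bounded_clinear_op_compose[OF X E2.V]])
    show "V1 (X (abs_op T2 x)) - X (V2 (abs_op T2 x)) = 0" for x
      by (simp only: PX[symmetric] E1.T_eq[symmetric] E2.T_eq[symmetric] TX diff_self)
  qed
  then show "V1 (X x) = X (V2 x)" by simp
qed

lemma intertwines_imp_extension:
  assumes VX: "\<And>x. V1 (X x) = X (V2 x)" and PX: "\<And>x. abs_op T1 (X x) = X (abs_op T2 x)"
  shows "\<exists>Y. bounded_clinear_op Y \<and> Y \<circ> U2 = U1 \<circ> X \<and> N1 \<circ> Y = Y \<circ> N2"
proof -
  \<comment> \<open>The graph of the intended extension: \<open>X\<close> acts on the coefficients
    of a combination.\<close>
  define G where "G = {(E2.combination m x, E1.combination m (\<lambda>k. X (x k))) | m x. True}"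
  obtain K where K: "\<And>x. norm (X x) \<le> norm x * K"
    using bounded_clinear_op_pos_bound[OF X] by metis
  interpret X: bounded_linear X by (rule bounded_clinear_opD[OF X])
  have model: "E1.model m (\<lambda>k. X (x k)) = X (E2.model m x)" for m x
    by (simp add: E1.model_def E2.model_def X.sum funpow_commute[of X V2 V1, OF VX[symmetric]]
        funpow_commute[of X "abs_op T2" "abs_op T1", OF PX[symmetric]])
  obtain Y where Y: "bounded_clinear_op Y" and YG: "\<And>y z. (y, z) \<in> G \<Longrightarrow> Y y = z"
  proof (rule bounded_extension)
    \<comment> \<open>Both norms are norms of models in the original spaces, and \<open>X\<close>
      carries one model to the other.\<close>
    show "norm z \<le> norm y * K" if "(y, z) \<in> G" for y z
      using that K by (auto simp: G_def E1.norm_combination E2.norm_combination model)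
    show "closure (fst ` G) = UNIV"
    proof -
      have "fst ` G = {E2.combination m x | m x. True}" by (force simp: G_def)
      then show ?thesis using E2.combinations_dense by simp
    qed
    show "(scaleC c y, scaleC c z) \<in> G" if yz: "(y, z) \<in> G" for c y z
    proof -
      obtain m x where "y = E2.combination m x" "z = E1.combination m (\<lambda>k. X (x k))"
        using yz by (auto simp: G_def)
      then have "scaleC c y = E2.combination m (\<lambda>k. scaleC c (x k))"
        "scaleC c z = E1.combination m (\<lambda>k. X (scaleC c (x k)))"
        by (simp_all add: E1.combination_scaleC E2.combination_scaleC bounded_clinear_opD(2)[OF X])
      then show ?thesis unfolding G_def by blast
    qed
    show "(y + y', z + z') \<in> G" if yz: "(y, z) \<in> G" "(y', z') \<in> G" for y z y' z'
    proof -
      obtain m x n x' where 1: "y = E2.combination m x" "z = E1.combination m (\<lambda>k. X (x k))"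
        "y' = E2.combination n x'" "z' = E1.combination n (\<lambda>k. X (x' k))"
        using yz by (auto simp: G_def)
      define w where "w = (\<lambda>k. (if k < m then x k else 0) + (if k < n then x' k else 0))"
      have Xw: "(\<lambda>k. X (w k)) =
          (\<lambda>k. (if k < m then X (x k) else 0) + (if k < n then X (x' k) else 0))"
        by (auto simp: w_def X.add X.zero)
      have "y + y' = E2.combination (max m n) w"
        by (simp only: 1 w_def E2.combination_add E2.combination_pad max.cobounded1 max.cobounded2)
      moreover have "z + z' = E1.combination (max m n) (\<lambda>k. X (w k))"
        by (simp only: 1 Xw E1.combination_add E1.combination_pad max.cobounded1 max.cobounded2)
      ultimately show ?thesis unfolding G_def by blast
    qed
  qed (rule that, assumption, blast)
  have YC: "Y (E2.combination m x) = E1.combination m (\<lambda>k. X (x k))" for m x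
    by (rule YG) (auto simp: G_def)
  have "Y (U2 x) = U1 (X x)" for x
    using YC[of 1 "\<lambda>_. x"] by (simp only: E1.combination_single E2.combination_single)
  moreover have "N1 (Y z) = Y (N2 z)" for z
  proof -
    \<comment> \<open>The difference is continuous and vanishes on the dense set of
      combinations.\<close>
    have "N1 (Y z) - Y (N2 z) = 0"
    proof (rule continuous_constant_on_closure[where f = "\<lambda>z. N1 (Y z) - Y (N2 z)"])
      show "continuous_on (closure {E2.combination m x | m x. True}) (\<lambda>z. N1 (Y z) - Y (N2 z))"
        by (rule linear_continuous_on[OF bounded_clinear_opD(1)[OF bounded_clinear_op_diff[OF
                  bounded_clinear_op_compose[OF E1.N Y] bounded_clinear_op_compose[OF Y E2.N]]]])
      have TX: "T1 (X x) = X (T2 x)" for x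
        by (simp only: E1.T_eq[of "X x"] E2.T_eq[of x] PX VX)
      show "N1 (Y z) - Y (N2 z) = 0" if "z \<in> {E2.combination m x | m x. True}" for z
        using that by (auto simp: YC E1.N_combination E2.N_combination TX)
      show "z \<in> closure {E2.combination m x | m x. True}" unfolding E2.combinations_dense by simp
    qed
    then show ?thesis by simp
  qed
  ultimately show ?thesis using Y by (intro exI[of _ Y]) (simp add: fun_eq_iff)
qed

text \<open>The difference \<open>D\<close> intertwines as well, so by Fuglede-Putnam its kernel is
  invariant under \<open>E2.M\<close> besides \<open>N2\<close>; it contains
  \<open>range U2\<close>, and minimality of \<open>N2\<close> makes it everything.\<close>

lemma extension_unique:
  assumes Y: "bounded_clinear_op Y" "Y \<circ> U2 = U1 \<circ> X" "N1 \<circ> Y = Y \<circ> N2"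
    and Z: "bounded_clinear_op Z" "Z \<circ> U2 = U1 \<circ> X" "N1 \<circ> Z = Z \<circ> N2"
  shows "Y = Z"
proof -
  define D where "D x = Y x - Z x" for x
  have D: "bounded_clinear_op D" unfolding D_def by (rule bounded_clinear_op_diff[OF Y(1) Z(1)])
  interpret D: bounded_linear D by (rule bounded_clinear_opD[OF D])
  have ND: "N1 (D x) = D (N2 x)" for x
    using Y(3) Z(3) linear_diff[OF bounded_linear.linear[OF bounded_clinear_opD(1)[OF E1.N]]]
    by (simp add: D_def fun_eq_iff)
  then have MD: "E1.M (D x) = D (E2.M x)" for x
    by (intro intertwines_adjoints[OF D]) (simp add: fun_eq_iff)
  have zero: "N1 0 = 0" "E1.M 0 = 0"
    using bounded_clinear_opD(1)[OF E1.N] bounded_clinear_opD(1)[OF E1.M]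
    by (auto intro: linear_0 bounded_linear.linear)
  have "{x. D x = 0} = UNIV"
  proof (rule E2.minimal)
    have "closed {x. D x = 0}"
      by (intro closed_Collect_eq linear_continuous_on D.bounded_linear continuous_on_const)
    then show "reducing_subspace N2 {x. D x = 0}"
      unfolding reducing_subspace_def closed_csubspace_def
      by (auto simp: D.zero D.add bounded_clinear_opD(2)[OF D] ND[symmetric] MD[symmetric] zero)
    show "range U2 \<subseteq> {x. D x = 0}" using Y(2) Z(2) by (auto simp: D_def fun_eq_iff)
  qed
  then show ?thesis by (auto simp: D_def fun_eq_iff)
qed

end

theorem theorem5p3:
  fixes T1 V1 :: "'h1::chilbert_space \<Rightarrow> 'h1"
    and T2 V2 :: "'h2::chilbert_space \<Rightarrow> 'h2"
    and N1 :: "'k1::chilbert_space \<Rightarrow> 'k1" and U1 :: "'h1 \<Rightarrow> 'k1"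
    and N2 :: "'k2::chilbert_space \<Rightarrow> 'k2" and U2 :: "'h2 \<Rightarrow> 'k2"
    and X :: "'h2 \<Rightarrow> 'h1"
  assumes "quasinormal T1" and "inj T1" and "polar_decomposition V1 T1"
    and "quasinormal T2" and "inj T2" and "polar_decomposition V2 T2"
    and "minimal_normal_extension N1 U1 T1"
    and "minimal_normal_extension N2 U2 T2"
    and "bounded_clinear_op X"
  shows "((\<exists>Xh :: 'k2 \<Rightarrow> 'k1. bounded_clinear_op Xh \<and> Xh \<circ> U2 = U1 \<circ> X \<and> N1 \<circ> Xh = Xh \<circ> N2)
           \<longleftrightarrow> (V1 \<circ> X = X \<circ> V2 \<and> abs_op T1 \<circ> X = X \<circ> abs_op T2)) \<and>
         (\<forall>Xh Xh' :: 'k2 \<Rightarrow> 'k1.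
           bounded_clinear_op Xh \<and> Xh \<circ> U2 = U1 \<circ> X \<and> N1 \<circ> Xh = Xh \<circ> N2 \<and>
           bounded_clinear_op Xh' \<and> Xh' \<circ> U2 = U1 \<circ> X \<and> N1 \<circ> Xh' = Xh' \<circ> N2
           \<longrightarrow> Xh = Xh')"
proof -
  interpret normal_extension_pair T1 V1 N1 U1 T2 V2 N2 U2 X
    by unfold_locales (fact assms)+
  show ?thesis
  proof (intro conjI iffI allI impI)
    assume "\<exists>Xh. bounded_clinear_op Xh \<and> Xh \<circ> U2 = U1 \<circ> X \<and> N1 \<circ> Xh = Xh \<circ> N2"
    then obtain Xh where Xh: "bounded_clinear_op Xh" "Xh \<circ> U2 = U1 \<circ> X" "N1 \<circ> Xh = Xh \<circ> N2"
      by blast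
    show "V1 \<circ> X = X \<circ> V2" "abs_op T1 \<circ> X = X \<circ> abs_op T2"
      using extension_imp_intertwines[OF Xh] by (simp_all add: fun_eq_iff)
  next
    assume "V1 \<circ> X = X \<circ> V2 \<and> abs_op T1 \<circ> X = X \<circ> abs_op T2"
    then show "\<exists>Xh. bounded_clinear_op Xh \<and> Xh \<circ> U2 = U1 \<circ> X \<and> N1 \<circ> Xh = Xh \<circ> N2"
      by (intro intertwines_imp_extension) (simp_all add: fun_eq_iff)
  next
    fix Xh Xh' :: "'k2 \<Rightarrow> 'k1"
    assume "bounded_clinear_op Xh \<and> Xh \<circ> U2 = U1 \<circ> X \<and> N1 \<circ> Xh = Xh \<circ> N2 \<and>
        bounded_clinear_op Xh' \<and> Xh' \<circ> U2 = U1 \<circ> X \<and> N1 \<circ> Xh' = Xh' \<circ> N2"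
    then show "Xh = Xh'" by (elim conjE) (rule extension_unique)
  qed
qed

end
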